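(* Let $A$ be a punctual injection structure which is relatively $\Delta^0_3$-categorical but not relatively $\Delta^0_2$-categorical. Then $\mathrm{PRCatSpec}(A)=\mathrm{Cone}(\Delta^0_3)$.
   Context: A punctual structure is a structure with domain $\omega$ whose operations and relations are uniformly primitive recursive. An injection structure is a structure $(D,f)$ in the language of one unary function symbol, with $f:D\to D$ injective. A computable structure $A$ is relatively $\Delta^0_\alpha$-categorical if for every structure $B\cong A$ with domain $\omega$ (not necessarily computable) there is an isomorphism from $A$ to $B$ which is $\Delta^0_\alpha$ relative to the atomic diagram of $B$. For total functions $f,g:\omega\to\omega$, write $f\leq_{PR} g$ if there is a primitive recursive scheme $\Psi$ (a primitive recursive definition which may additionally use the oracle function as a basic function) with $\Psi^{g}=f$. Write $f\equiv_{PR}g$ if $f\leq_{PR}g$ and $g\leq_{PR}f$. The $\equiv_{PR}$-classes are the PR-degrees, ordered by $\leq_{PR}$. For a punctual structure $A$, $\mathrm{PRCatSpec}(A)$ is the set of all PR-degrees $\mathbf d$ such that for every punctual structure $B\cong A$ there is an isomorphism $f:A\to B$ with $f\leq_{PR}\mathbf d$ and $f^{-1}\leq_{PR}\mathbf d$. For a computable ordinal $\alpha>0$, $\mathrm{Cone}(\Delta^0_\alpha)$ is the set of all PR-degrees $\mathbf d$ such that $f\leq_{PR}\mathbf d$ for every total $\Delta^0_\alpha$ function $f:\omega\to\omega$. *)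

theory Defs
  imports Main "HOL-Library.Nat_Bijection"
begin

section \<open>Primitive recursion and recursion relative to oracles\<close>

text \<open>
  A \<open>k\<close>-ary function on \<open>\<omega>\<close> is represented by a function on lists; only its values on lists of
  length \<open>k\<close> are meaningful. The set \<open>X\<close> collects the additional basic functions:
  \<open>X = {}\<close> gives the unrelativized notion, \<open>X = {g}\<close> the notion relative to the oracle \<open>g\<close>.
\<close>

inductive primrec_in :: "(nat \<Rightarrow> nat) set \<Rightarrow> nat \<Rightarrow> (nat list \<Rightarrow> nat) \<Rightarrow> bool"
  for X :: "(nat \<Rightarrow> nat) set"
where
  zero: "primrec_in X 0 (\<lambda>xs. 0)"
| succ: "primrec_in X 1 (\<lambda>xs. Suc (xs ! 0))"
| proj: "i < k \<Longrightarrow> primrec_in X k (\<lambda>xs. xs ! i)"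
| basic: "g \<in> X \<Longrightarrow> primrec_in X 1 (\<lambda>xs. g (xs ! 0))"
| comp: "\<lbrakk>primrec_in X (length Gs) F; \<And>G. G \<in> set Gs \<Longrightarrow> primrec_in X k G\<rbrakk>
    \<Longrightarrow> primrec_in X k (\<lambda>xs. F (map (\<lambda>G. G xs) Gs))"
| prec: "\<lbrakk>primrec_in X k F; primrec_in X (k + 2) G\<rbrakk>
    \<Longrightarrow> primrec_in X (k + 1)
          (\<lambda>xs. rec_nat (F (tl xs)) (\<lambda>y r. G (y # r # tl xs)) (hd xs))"

text \<open>
  The total recursive functions: minimization is only applied to regular functions, so that
  all functions generated are total.
\<close>

inductive recursive_in :: "(nat \<Rightarrow> nat) set \<Rightarrow> nat \<Rightarrow> (nat list \<Rightarrow> nat) \<Rightarrow> bool"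
  for X :: "(nat \<Rightarrow> nat) set"
where
  zero: "recursive_in X 0 (\<lambda>xs. 0)"
| succ: "recursive_in X 1 (\<lambda>xs. Suc (xs ! 0))"
| proj: "i < k \<Longrightarrow> recursive_in X k (\<lambda>xs. xs ! i)"
| basic: "g \<in> X \<Longrightarrow> recursive_in X 1 (\<lambda>xs. g (xs ! 0))"
| comp: "\<lbrakk>recursive_in X (length Gs) F; \<And>G. G \<in> set Gs \<Longrightarrow> recursive_in X k G\<rbrakk>
    \<Longrightarrow> recursive_in X k (\<lambda>xs. F (map (\<lambda>G. G xs) Gs))"
| prec: "\<lbrakk>recursive_in X k F; recursive_in X (k + 2) G\<rbrakk>
    \<Longrightarrow> recursive_in X (k + 1)
          (\<lambda>xs. rec_nat (F (tl xs)) (\<lambda>y r. G (y # r # tl xs)) (hd xs))"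
| mu: "\<lbrakk>recursive_in X (k + 1) F; \<And>xs. length xs = k \<Longrightarrow> \<exists>y. F (y # xs) = 0\<rbrakk>
    \<Longrightarrow> recursive_in X k (\<lambda>xs. LEAST y. F (y # xs) = 0)"


section \<open>The arithmetical hierarchy relative to oracles\<close>

text \<open>
  A \<open>k\<close>-ary relation is a predicate on lists, again only considered on lists of length \<open>k\<close>.
  At level \<open>0\<close> one has the recursive relations. The relations at level \<open>n + 1\<close> are the
  projections of the \<open>\<Pi>\<close>-relations at level \<open>n\<close>, i.e. of the complements \<open>\<lambda>ys. \<not> Q ys\<close> of
  \<open>\<Sigma>\<close>-relations \<open>Q\<close> at level \<open>n\<close>.
\<close>

primrec Sigma0_in :: "(nat \<Rightarrow> nat) set \<Rightarrow> nat \<Rightarrow> nat \<Rightarrow> (nat list \<Rightarrow> bool) \<Rightarrow> bool" where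
  "Sigma0_in X 0 k P \<longleftrightarrow>
     (\<exists>F. recursive_in X k F \<and> (\<forall>xs. length xs = k \<longrightarrow> F xs = (if P xs then 1 else 0)))"
| "Sigma0_in X (Suc n) k P \<longleftrightarrow>
     (\<exists>Q. Sigma0_in X n (Suc k) Q \<and> (\<forall>xs. length xs = k \<longrightarrow> P xs = (\<exists>y. \<not> Q (y # xs))))"

definition Pi0_in :: "(nat \<Rightarrow> nat) set \<Rightarrow> nat \<Rightarrow> nat \<Rightarrow> (nat list \<Rightarrow> bool) \<Rightarrow> bool" where
  "Pi0_in X n k P \<longleftrightarrow> Sigma0_in X n k (\<lambda>xs. \<not> P xs)"

definition Delta0_in :: "(nat \<Rightarrow> nat) set \<Rightarrow> nat \<Rightarrow> nat \<Rightarrow> (nat list \<Rightarrow> bool) \<Rightarrow> bool" where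
  "Delta0_in X n k P \<longleftrightarrow> Sigma0_in X n k P \<and> Pi0_in X n k P"

text \<open>A total function is \<open>\<Delta>\<^sup>0\<^sub>n\<close> if its graph is.\<close>

definition Delta0_fun_in :: "(nat \<Rightarrow> nat) set \<Rightarrow> nat \<Rightarrow> (nat \<Rightarrow> nat) \<Rightarrow> bool" where
  "Delta0_fun_in X n f \<longleftrightarrow> Delta0_in X n 2 (\<lambda>xs. f (xs ! 0) = xs ! 1)"


section \<open>Structures with one unary function on \<open>\<omega>\<close>\<close>

text \<open>A structure \<open>(\<omega>, A)\<close> with one unary function \<open>A\<close> is represented by that function.\<close>

definition punctual :: "(nat \<Rightarrow> nat) \<Rightarrow> bool" where
  "punctual A \<longleftrightarrow> (\<exists>F. primrec_in {} 1 F \<and> (\<forall>x. F [x] = A x))"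

definition injection_structure :: "(nat \<Rightarrow> nat) \<Rightarrow> bool" where
  "injection_structure A \<longleftrightarrow> inj A"

definition isomorphism :: "(nat \<Rightarrow> nat) \<Rightarrow> (nat \<Rightarrow> nat) \<Rightarrow> (nat \<Rightarrow> nat) \<Rightarrow> bool" where
  "isomorphism A B h \<longleftrightarrow> bij h \<and> (\<forall>x. h (A x) = B (h x))"

definition isomorphic :: "(nat \<Rightarrow> nat) \<Rightarrow> (nat \<Rightarrow> nat) \<Rightarrow> bool" where
  "isomorphic A B \<longleftrightarrow> (\<exists>h. isomorphism A B h)"

text \<open>
  With constants for the elements of \<open>\<omega>\<close>, the closed terms are \<open>f\<^sup>i(a)\<close> and the atomic sentences
  are \<open>f\<^sup>i(a) = f\<^sup>j(b)\<close>. Such a sentence is coded by \<open>[1, i, a, j, b]\<close> and its negation by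
  \<open>[0, i, a, j, b]\<close>.
\<close>

definition atomic_diagram :: "(nat \<Rightarrow> nat) \<Rightarrow> nat set" where
  "atomic_diagram B =
     {list_encode [1, i, a, j, b] | i a j b. (B ^^ i) a = (B ^^ j) b} \<union>
     {list_encode [0, i, a, j, b] | i a j b. (B ^^ i) a \<noteq> (B ^^ j) b}"

definition char_fun :: "nat set \<Rightarrow> nat \<Rightarrow> nat" where
  "char_fun S x = (if x \<in> S then 1 else 0)"

definition relatively_Delta0_categorical :: "nat \<Rightarrow> (nat \<Rightarrow> nat) \<Rightarrow> bool" where
  "relatively_Delta0_categorical n A \<longleftrightarrow>
     (\<forall>B. isomorphic B A \<longrightarrow>
        (\<exists>h. isomorphism A B h \<and> Delta0_fun_in {char_fun (atomic_diagram B)} n h))"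


section \<open>PR-degrees\<close>

definition PR_reducible :: "(nat \<Rightarrow> nat) \<Rightarrow> (nat \<Rightarrow> nat) \<Rightarrow> bool"  (infix \<open>\<le>PR\<close> 50) where
  "f \<le>PR g \<longleftrightarrow> (\<exists>F. primrec_in {g} 1 F \<and> (\<forall>x. F [x] = f x))"

definition PR_equiv :: "(nat \<Rightarrow> nat) \<Rightarrow> (nat \<Rightarrow> nat) \<Rightarrow> bool"  (infix \<open>\<equiv>PR\<close> 50) where
  "f \<equiv>PR g \<longleftrightarrow> f \<le>PR g \<and> g \<le>PR f"

definition PR_degrees :: "(nat \<Rightarrow> nat) set set" where
  "PR_degrees = UNIV // {(f, g). f \<equiv>PR g}"

definition below_degree :: "(nat \<Rightarrow> nat) \<Rightarrow> (nat \<Rightarrow> nat) set \<Rightarrow> bool" where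
  "below_degree f d \<longleftrightarrow> (\<exists>g\<in>d. f \<le>PR g)"

definition PRCatSpec :: "(nat \<Rightarrow> nat) \<Rightarrow> (nat \<Rightarrow> nat) set set" where
  "PRCatSpec A = {d \<in> PR_degrees. \<forall>B. punctual B \<longrightarrow> isomorphic B A \<longrightarrow>
     (\<exists>h. isomorphism A B h \<and> below_degree h d \<and> below_degree (inv h) d)}"

definition Cone_Delta0 :: "nat \<Rightarrow> (nat \<Rightarrow> nat) set set" where
  "Cone_Delta0 n = {d \<in> PR_degrees. \<forall>f. Delta0_fun_in {} n f \<longrightarrow> below_degree f d}"

end

theory Submission
  imports Defs "HOL-Library.Infinite_Set"
begin


text \<open>A punctual copy must give each value of its map at once, without waiting for
  information. Both copies are therefore built from guesses, and a wrong guess simply runs off as an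
  orbit of type \<open>\<omega>\<close>; as \<open>A\<close> has infinitely many of these, the
  surplus does no harm. Even periods are guessed, since primitive recursion can verify a period but
  not search for one. An injection structure is determined up to isomorphism by the number of orbits
  of each type, so such a copy is isomorphic to \<open>A\<close> although no effective isomorphism
  is in sight. Whether a row becomes an orbit of type \<int> is a
  \<open>\<Pi>\<^sup>0\<^sub>2\<close> question (does it fire infinitely often?), whereas the graph
  of \<open>f\<close> is only \<open>\<Sigma>\<^sup>0\<^sub>3\<close>. The missing existential
  witness is made part of the index of the row, and it has to be unique: if many rows stood for the
  same number, then \<open>x + 1\<close> different orbits might all belong to numbers below
  \<open>x\<close>, and the pigeonhole step would fail.\<close>

text \<open>
  The atomic diagram of a punctual structure \<open>B\<close> is recursive, so an isomorphism from \<open>A\<close> to \<open>B\<close> that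
  is \<open>\<Delta>\<^sup>0\<^sub>3\<close> in it is \<open>\<Delta>\<^sup>0\<^sub>3\<close>, and so is its inverse; this puts the cone inside the spectrum.

  Conversely, if \<open>A\<close> had only finitely many orbits of type \<open>\<omega>\<close>, or only finitely many of type \<open>\<int>\<close>,
  then the types of its orbits would be decidable in the limit, and matching the orbits of each type
  in increasing order would give relative \<open>\<Delta>\<^sup>0\<^sub>2\<close>-categoricity. So \<open>A\<close> has infinitely many of both.
  Given a \<open>\<Delta>\<^sup>0\<^sub>3\<close> function \<open>f\<close>, one then finds two punctual copies of \<open>A\<close>: in the first, representatives
  of infinitely many \<open>\<int>\<close>-orbits can be listed primitive recursively; in the second, the \<open>\<int>\<close>-orbits
  correspond to numbers \<open>x\<close>, one orbit for each \<open>x\<close>, and any element of the orbit for \<open>x\<close> reveals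
  \<open>f 0, \<dots>, f x\<close>. An isomorphism sends \<open>x + 1\<close> listed representatives to different \<open>\<int>\<close>-orbits, one of
  which belongs to some \<open>x' \<ge> x\<close> and reveals \<open>f x\<close>. As the isomorphism factors through \<open>A\<close>, every
  degree in the spectrum computes it, and with it \<open>f\<close>.
\<close>


section \<open>Primitive recursive functions\<close>

text \<open>Only the values on lists of length \<open>k\<close> matter, whereas \<^const>\<open>primrec_in\<close> also fixes the values on
  all other lists; hence the closure under agreement on lists of length \<open>k\<close>.\<close>

definition pr :: "(nat \<Rightarrow> nat) set \<Rightarrow> nat \<Rightarrow> (nat list \<Rightarrow> nat) \<Rightarrow> bool" where
  "pr X k f \<longleftrightarrow> (\<exists>F. primrec_in X k F \<and> (\<forall>xs. length xs = k \<longrightarrow> F xs = f xs))"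

text \<open>Tuples of functions with a tracked length: argument lists built with \<open>#\<close>
  and \<open>tl\<close> can then be fed into a composition by syntax-directed rules.\<close>

definition prl :: "(nat \<Rightarrow> nat) set \<Rightarrow> nat \<Rightarrow> nat \<Rightarrow> (nat list \<Rightarrow> nat list) \<Rightarrow> bool" where
  "prl X k m \<phi> \<longleftrightarrow> (\<forall>xs. length xs = k \<longrightarrow> length (\<phi> xs) = m) \<and> (\<forall>i<m. pr X k (\<lambda>xs. \<phi> xs ! i))"

definition prP :: "(nat \<Rightarrow> nat) set \<Rightarrow> nat \<Rightarrow> (nat list \<Rightarrow> bool) \<Rightarrow> bool" where
  "prP X k P \<longleftrightarrow> pr X k (\<lambda>xs. of_bool (P xs))"

named_theorems pr_intros

lemma pr_cong:
  assumes "pr X k g" and "\<And>xs. length xs = k \<Longrightarrow> f xs = g xs"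
  shows "pr X k f"
  using assms unfolding pr_def by metis

lemma prP_cong:
  assumes "prP X k Q" and "\<And>xs. length xs = k \<Longrightarrow> P xs = Q xs"
  shows "prP X k P"
  using assms(1) unfolding prP_def by (rule pr_cong) (simp add: assms(2))

lemma primrec_in_pr: "primrec_in X k F \<Longrightarrow> pr X k F"
  unfolding pr_def by blast

lemma pr_proj: "i < k \<Longrightarrow> pr X k (\<lambda>xs. xs ! i)"
  by (intro primrec_in_pr primrec_in.proj)

text \<open>The length equation is a separate premise so that the rule unifies with any syntactic
  form of the arity; goals such as \<open>Suc (Suc k) = k + 2\<close> are left to the
  simplifier.\<close>

lemma pr_comp:
  assumes G: "pr X m G" and p: "prl X k m' \<phi>" and m: "m' = m"
  shows "pr X k (\<lambda>xs. G (\<phi> xs))"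
proof -
  obtain G' where G': "primrec_in X m G'" "\<And>xs. length xs = m \<Longrightarrow> G' xs = G xs"
    using G unfolding pr_def by blast
  have "\<forall>i<m. \<exists>F. primrec_in X k F \<and> (\<forall>xs. length xs = k \<longrightarrow> F xs = \<phi> xs ! i)"
    using p m unfolding prl_def pr_def by blast
  then obtain F where F: "\<And>i. i < m \<Longrightarrow> primrec_in X k (F i)"
      "\<And>i xs. i < m \<Longrightarrow> length xs = k \<Longrightarrow> F i xs = \<phi> xs ! i"
    by metis
  have "primrec_in X k (\<lambda>xs. G' (map (\<lambda>G. G xs) (map F [0..<m])))"
    using G'(1) F(1) by (intro primrec_in.comp) auto
  moreover have "map (\<lambda>G. G xs) (map F [0..<m]) = \<phi> xs" if "length xs = k" for xs
    using that p m F(2) by (intro nth_equalityI) (auto simp: prl_def)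
  moreover have "length (\<phi> xs) = m" if "length xs = k" for xs
    using that p m by (auto simp: prl_def)
  ultimately show ?thesis
    unfolding pr_def
    by (intro exI[of _ "\<lambda>xs. G' (map (\<lambda>G. G xs) (map F [0..<m]))"]) (simp del: map_map add: G'(2))
qed

lemma prl_Nil [pr_intros]: "prl X k 0 (\<lambda>xs. [])"
  by (simp add: prl_def)

lemma prl_Cons [pr_intros]:
  assumes "pr X k f" and "prl X k m \<phi>" shows "prl X k (Suc m) (\<lambda>xs. f xs # \<phi> xs)"
  using assms by (auto simp: prl_def less_Suc_eq_0_disj)

lemma prl_id [pr_intros]: "prl X k k (\<lambda>xs. xs)"
  by (simp add: prl_def pr_proj)

lemma prl_tl [pr_intros]:
  assumes "prl X k m \<phi>" shows "prl X k (m - 1) (\<lambda>xs. tl (\<phi> xs))"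
proof -
  have "pr X k (\<lambda>xs. tl (\<phi> xs) ! i)" if "i < m - 1" for i
    by (rule pr_cong[of _ _ "\<lambda>xs. \<phi> xs ! Suc i"])
      (use assms that in \<open>auto simp: prl_def nth_tl\<close>)
  then show ?thesis using assms by (simp add: prl_def)
qed

lemma pr_nth [pr_intros]: "prl X k m \<phi> \<Longrightarrow> i < m \<Longrightarrow> pr X k (\<lambda>xs. \<phi> xs ! i)"
  by (simp add: prl_def)

lemma pr_hd [pr_intros]:
  assumes "prl X k m \<phi>" and "0 < m" shows "pr X k (\<lambda>xs. hd (\<phi> xs))"
proof (rule pr_cong)
  show "pr X k (\<lambda>xs. \<phi> xs ! 0)" using assms by (simp add: prl_def)
  show "hd (\<phi> xs) = \<phi> xs ! 0" if "length xs = k" for xs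
    using assms that by (intro hd_conv_nth) (auto simp: prl_def)
qed

lemma pr_Suc [pr_intros]:
  assumes "pr X k f" shows "pr X k (\<lambda>xs. Suc (f xs))"
  using pr_comp[OF primrec_in_pr[OF primrec_in.succ] prl_Cons[OF assms prl_Nil]] by simp

lemma pr_const [pr_intros]: "pr X k (\<lambda>xs. c)"
proof (induction c)
  case 0
  show ?case using pr_comp[OF primrec_in_pr[OF primrec_in.zero] prl_Nil] by simp
qed (rule pr_Suc)

lemma pr_rec:
  assumes "pr X k b" "pr X (k + 2) (\<lambda>ys. g (hd ys) (hd (tl ys)) (tl (tl ys)))" "pr X k n"
  shows "pr X k (\<lambda>xs. rec_nat (b xs) (\<lambda>y r. g y r xs) (n xs))"
proof -
  obtain F G where F: "primrec_in X k F" "\<And>xs. length xs = k \<Longrightarrow> F xs = b xs"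
    and G: "primrec_in X (k + 2) G"
      "\<And>ys. length ys = k + 2 \<Longrightarrow> G ys = g (hd ys) (hd (tl ys)) (tl (tl ys))"
    using assms(1,2) unfolding pr_def by blast
  have "pr X (k + 1) (\<lambda>xs. rec_nat (F (tl xs)) (\<lambda>y r. G (y # r # tl xs)) (hd xs))"
    by (intro primrec_in_pr primrec_in.prec F G)
  from pr_comp[OF this prl_Cons[OF assms(3) prl_id]]
  have "pr X k (\<lambda>xs. rec_nat (F xs) (\<lambda>y r. G (y # r # xs)) (n xs))" by simp
  then show ?thesis
    by (rule pr_cong) (simp add: F(2) G(2))
qed

lemma pr_add [pr_intros]:
  assumes "pr X k f" "pr X k g" shows "pr X k (\<lambda>xs. f xs + g xs)"
proof (rule pr_cong)
  show "pr X k (\<lambda>xs. rec_nat (f xs) (\<lambda>y r. Suc r) (g xs))"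
    using assms by (intro pr_rec) (rule pr_intros | simp)+
  have "rec_nat a (\<lambda>y r. Suc r) b = a + b" for a b :: nat by (induction b) auto
  then show "f xs + g xs = rec_nat (f xs) (\<lambda>y r. Suc r) (g xs)" for xs by simp
qed

lemma pr_mult [pr_intros]:
  assumes "pr X k f" "pr X k g" shows "pr X k (\<lambda>xs. f xs * g xs)"
proof (rule pr_cong)
  have *: "pr X (k + 2) (\<lambda>xs. f (tl (tl xs)))"
    by (rule pr_comp[OF assms(1)]) (rule pr_intros | simp)+
  show "pr X k (\<lambda>xs. rec_nat 0 (\<lambda>y r. r + f xs) (g xs))"
    by (rule pr_rec[OF pr_const _ assms(2)]) (rule pr_add pr_hd prl_tl prl_id * | simp)+
  have "rec_nat 0 (\<lambda>y r. r + a) b = a * b" for a b :: nat by (induction b) auto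
  then show "f xs * g xs = rec_nat 0 (\<lambda>y r. r + f xs) (g xs)" for xs by simp
qed

lemma pr_pred [pr_intros]:
  assumes "pr X k f" shows "pr X k (\<lambda>xs. f xs - 1)"
proof (rule pr_cong)
  show "pr X k (\<lambda>xs. rec_nat 0 (\<lambda>y r. y) (f xs))"
    using assms by (intro pr_rec) (rule pr_intros | simp)+
  have "rec_nat 0 (\<lambda>y r. y) b = b - 1" for b :: nat by (cases b) auto
  then show "f xs - 1 = rec_nat 0 (\<lambda>y r. y) (f xs)" for xs by simp
qed

lemma pr_diff [pr_intros]:
  assumes "pr X k f" "pr X k g" shows "pr X k (\<lambda>xs. f xs - g xs)"
proof (rule pr_cong)
  show "pr X k (\<lambda>xs. rec_nat (f xs) (\<lambda>y r. r - 1) (g xs))"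
    using assms by (intro pr_rec) (rule pr_intros assms | simp only: | simp)+
  have "rec_nat a (\<lambda>y r. r - 1) b = a - b" for a b :: nat by (induction b) auto
  then show "f xs - g xs = rec_nat (f xs) (\<lambda>y r. r - 1) (g xs)" for xs by simp
qed

lemma prP_not [pr_intros]:
  assumes "prP X k P" shows "prP X k (\<lambda>xs. \<not> P xs)"
  unfolding prP_def
  by (rule pr_cong[OF pr_diff[OF pr_const[of _ _ 1] assms[unfolded prP_def]]]) simp

lemma prP_conj [pr_intros]:
  assumes "prP X k P" "prP X k Q" shows "prP X k (\<lambda>xs. P xs \<and> Q xs)"
  unfolding prP_def
  by (rule pr_cong[OF pr_mult[OF assms[unfolded prP_def]]]) simp

lemma prP_disj [pr_intros]:
  assumes "prP X k P" "prP X k Q" shows "prP X k (\<lambda>xs. P xs \<or> Q xs)"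
  by (rule prP_cong[OF prP_not[OF prP_conj[OF prP_not[OF assms(1)] prP_not[OF assms(2)]]]]) simp

lemma prP_imp [pr_intros]:
  assumes "prP X k P" "prP X k Q" shows "prP X k (\<lambda>xs. P xs \<longrightarrow> Q xs)"
  by (rule prP_cong[OF prP_disj[OF prP_not[OF assms(1)] assms(2)]]) simp

lemma prP_le [pr_intros]:
  assumes "pr X k f" "pr X k g" shows "prP X k (\<lambda>xs. f xs \<le> g xs)"
  unfolding prP_def
  by (rule pr_cong[OF pr_diff[OF pr_const[of _ _ 1] pr_diff[OF assms]]]) auto

lemma prP_less [pr_intros]:
  assumes "pr X k f" "pr X k g" shows "prP X k (\<lambda>xs. f xs < g xs)"
  by (rule prP_cong[OF prP_le[OF pr_Suc[OF assms(1)] assms(2)]]) auto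

lemma prP_eq [pr_intros]:
  assumes "pr X k f" "pr X k g" shows "prP X k (\<lambda>xs. f xs = g xs)"
  by (rule prP_cong[OF prP_conj[OF prP_le[OF assms] prP_le[OF assms(2,1)]]]) auto

lemma prP_const [pr_intros]: "prP X k (\<lambda>xs. c)"
  by (simp add: prP_def pr_const)

lemma pr_if [pr_intros]:
  assumes "prP X k P" "pr X k f" "pr X k g" shows "pr X k (\<lambda>xs. if P xs then f xs else g xs)"
  by (rule pr_cong[OF pr_add[OF pr_mult[OF assms(1)[unfolded prP_def] assms(2)]
        pr_mult[OF prP_not[OF assms(1), unfolded prP_def] assms(3)]]]) simp

lemma prP_comp:
  assumes "prP X m P" "prl X k m' \<phi>" "m' = m" shows "prP X k (\<lambda>xs. P (\<phi> xs))"
  using pr_comp[OF assms(1)[unfolded prP_def] assms(2,3)] by (simp add: prP_def)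

lemma prP_bex [pr_intros]:
  assumes b: "pr X k b" and P: "prP X (Suc k) (\<lambda>ys. P (hd ys) (tl ys))"
  shows "prP X k (\<lambda>xs. \<exists>y<b xs. P y xs)"
  unfolding prP_def
proof (rule pr_cong)
  have "prP X (k + 2) (\<lambda>zs. P (hd (hd zs # tl (tl zs))) (tl (hd zs # tl (tl zs))))"
    by (rule prP_comp[OF P]) (rule pr_intros | simp)+
  then have *: "prP X (k + 2) (\<lambda>zs. P (hd zs) (tl (tl zs)))" by simp
  show "pr X k (\<lambda>xs. rec_nat 0 (\<lambda>y r. if P y xs then 1 else r) (b xs))"
    using b * by (intro pr_rec) (rule pr_intros | simp)+
  have "rec_nat 0 (\<lambda>y r. if P y xs then 1 else r) n = (of_bool (\<exists>y<n. P y xs) :: nat)" for n xs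
    by (induction n) (auto simp: less_Suc_eq)
  then show "(of_bool (\<exists>y<b xs. P y xs) :: nat) = rec_nat 0 (\<lambda>y r. if P y xs then 1 else r) (b xs)" for xs
    by (rule sym)
qed

lemma prP_ball [pr_intros]:
  assumes "pr X k b" and "prP X (Suc k) (\<lambda>ys. P (hd ys) (tl ys))"
  shows "prP X k (\<lambda>xs. \<forall>y<b xs. P y xs)"
  by (rule prP_cong[OF prP_not[OF prP_bex[OF assms(1) prP_not[OF assms(2)]]]]) simp

text \<open>One step of a bounded search. The alternative \<open>n \<le> y\<close> makes the bound
  the default value of a failed search.\<close>

lemma Least_or_bound_Suc:
  fixes Q :: "nat \<Rightarrow> bool"
  defines "l n \<equiv> LEAST y. Q y \<or> n \<le> y"
  shows "l (Suc n) = (if Q (l n) then l n else Suc (l n))"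
proof -
  have l: "Q (l n) \<or> n \<le> l n" "l n \<le> n" for n
    unfolding l_def by (rule LeastI[of _ n], simp) (rule Least_le, simp)
  have l3: "\<not> Q y \<and> y < n" if "y < l n" for n y
    using not_less_Least[OF that[unfolded l_def]] by auto
  show ?thesis
  proof (cases "Q (l n)")
    case True
    then have "l (Suc n) \<le> l n" unfolding l_def by (intro Least_le) auto
    moreover have "\<not> l (Suc n) < l n" using l(1)[of "Suc n"] l3[of "l (Suc n)" n] by auto
    ultimately show ?thesis using True by auto
  next
    case False
    then have n: "l n = n" using l(1,2)[of n] by auto
    have "\<not> l (Suc n) < Suc n"
      using l(1)[of "Suc n"] l3[of "l (Suc n)" n] False n by (auto simp: less_Suc_eq)
    then show ?thesis using False n l(2)[of "Suc n"] by auto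
  qed
qed

lemma pr_bmu [pr_intros]:
  assumes b: "pr X k b" and P: "prP X (Suc k) (\<lambda>ys. P (hd ys) (tl ys))"
  shows "pr X k (\<lambda>xs. LEAST y. P y xs \<or> b xs \<le> y)"
proof (rule pr_cong)
  have "prP X (k + 2) (\<lambda>zs. P (hd (tl zs)) (tl (tl zs)))"
    by (rule prP_comp[OF P]) (rule pr_intros | simp)+
  then show "pr X k (\<lambda>xs. rec_nat 0 (\<lambda>y r. if P r xs then r else Suc r) (b xs))"
    using b by (intro pr_rec) (rule pr_intros | simp)+
  have "rec_nat 0 (\<lambda>y r. if Q r then r else Suc r) n = (LEAST y. Q y \<or> n \<le> y)"
    for n and Q :: "nat \<Rightarrow> bool"
    by (induction n) (auto simp: Least_or_bound_Suc)
  then show "(LEAST y. P y xs \<or> b xs \<le> y)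
      = rec_nat 0 (\<lambda>y r. if P r xs then r else Suc r) (b xs)" for xs
    by simp
qed

lemma pr_funpow:
  assumes A: "pr X 1 (\<lambda>xs. A (xs ! 0))" and n: "pr X k n" and x: "pr X k x"
  shows "pr X k (\<lambda>xs. (A ^^ n xs) (x xs))"
proof (rule pr_cong)
  have "pr X (k + 2) (\<lambda>zs. A ([hd (tl zs)] ! 0))"
    by (rule pr_comp[OF A]) (rule pr_intros | simp)+
  then have *: "pr X (k + 2) (\<lambda>zs. A (hd (tl zs)))" by simp
  show "pr X k (\<lambda>xs. rec_nat (x xs) (\<lambda>y r. A r) (n xs))"
    by (rule pr_rec[OF x * n])
  have "rec_nat a (\<lambda>y r. A r) m = (A ^^ m) a" for a m by (induction m) auto
  then show "(A ^^ n xs) (x xs) = rec_nat (x xs) (\<lambda>y r. A r) (n xs)" for xs by simp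
qed

section \<open>Pairing and its inverse\<close>

lemma pr_triangle:
  assumes "pr X k f" shows "pr X k (\<lambda>xs. triangle (f xs))"
proof (rule pr_cong)
  show "pr X k (\<lambda>xs. rec_nat 0 (\<lambda>y r. r + Suc y) (f xs))"
    by (rule pr_rec[OF _ _ assms]) (rule pr_intros | simp)+
  have "rec_nat 0 (\<lambda>y r. r + Suc y) n = triangle n" for n by (induction n) auto
  then show "triangle (f xs) = rec_nat 0 (\<lambda>y r. r + Suc y) (f xs)" for xs by simp
qed

lemma pr_prod_encode [pr_intros]:
  assumes "pr X k f" "pr X k g" shows "pr X k (\<lambda>xs. prod_encode (f xs, g xs))"
  unfolding prod_encode_def by (simp, intro pr_add pr_triangle assms)

text \<open>Decoding is a bounded search, since both components are at most the code.\<close>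

lemma pr_fst_prod_decode [pr_intros]:
  assumes "pr X k f" shows "pr X k (\<lambda>xs. fst (prod_decode (f xs)))"
proof (rule pr_cong)
  have [pr_intros]: "pr X (Suc (Suc k)) (\<lambda>ys. f (tl (tl ys)))"
    by (rule pr_comp[OF assms]) (rule pr_intros | simp)+
  have [pr_intros]: "pr X (Suc k) (\<lambda>ys. f (tl ys))"
    by (rule pr_comp[OF assms]) (rule pr_intros | simp)+
  show "pr X k (\<lambda>xs. LEAST a. (\<exists>b<Suc (f xs). prod_encode (a, b) = f xs) \<or> Suc (f xs) \<le> a)"
    by (rule pr_intros assms | simp)+
  show "fst (prod_decode (f xs))
      = (LEAST a. (\<exists>b<Suc (f xs). prod_encode (a, b) = f xs) \<or> Suc (f xs) \<le> a)" for xs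
  proof -
    obtain a b where ab: "prod_decode (f xs) = (a, b)" by fastforce
    then have e: "f xs = prod_encode (a, b)" by (metis prod_decode_inverse)
    show ?thesis unfolding ab
      by (rule Least_equality[symmetric])
        (use e le_prod_encode_1[of a b] le_prod_encode_2[of b a] in
          \<open>auto simp: less_Suc_eq_le prod_encode_eq\<close>)
  qed
qed

lemma pr_snd_prod_decode [pr_intros]:
  assumes "pr X k f" shows "pr X k (\<lambda>xs. snd (prod_decode (f xs)))"
proof (rule pr_cong)
  have [pr_intros]: "pr X (Suc k) (\<lambda>ys. f (tl ys))"
    by (rule pr_comp[OF assms]) (rule pr_intros | simp)+
  show "pr X k (\<lambda>xs. LEAST b. prod_encode (fst (prod_decode (f xs)), b) = f xs \<or> Suc (f xs) \<le> b)"
    by (rule pr_intros assms | simp)+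
  show "snd (prod_decode (f xs))
      = (LEAST b. prod_encode (fst (prod_decode (f xs)), b) = f xs \<or> Suc (f xs) \<le> b)" for xs
  proof -
    obtain a b where ab: "prod_decode (f xs) = (a, b)" by fastforce
    then have e: "f xs = prod_encode (a, b)" by (metis prod_decode_inverse)
    show ?thesis unfolding ab
      by (rule Least_equality[symmetric])
        (use e le_prod_encode_2[of b a] in \<open>auto simp: prod_encode_eq\<close>)
  qed
qed



section \<open>Recursive functions and the arithmetical hierarchy\<close>

lemma primrec_in_recursive_in: "primrec_in X k F \<Longrightarrow> recursive_in X k F"
proof (induction rule: primrec_in.induct)
  case (comp Gs F k)
  then show ?case by (intro recursive_in.comp) auto
qed (rule recursive_in.intros; assumption)+

lemma recursive_in_oracle:
  assumes "recursive_in X k F" and X: "\<And>g. g \<in> X \<Longrightarrow> recursive_in Y 1 (\<lambda>xs. g (xs ! 0))"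
  shows "recursive_in Y k F"
  using assms(1)
proof (induction rule: recursive_in.induct)
  case (comp Gs F k)
  then show ?case by (intro recursive_in.comp) auto
qed (rule X recursive_in.intros; assumption)+

lemma Sigma0_in_oracle:
  assumes "Sigma0_in X n k P" and "\<And>g. g \<in> X \<Longrightarrow> recursive_in Y 1 (\<lambda>xs. g (xs ! 0))"
  shows "Sigma0_in Y n k P"
  using assms(1)
proof (induction n arbitrary: k P)
  case 0
  then show ?case using recursive_in_oracle[OF _ assms(2)] by fastforce
qed fastforce

lemma Sigma0_in_reindex:
  assumes "Sigma0_in X n k P" and "length \<sigma> = k" and "\<And>i. i \<in> set \<sigma> \<Longrightarrow> i < k'"
  shows "Sigma0_in X n k' (\<lambda>xs. P (map ((!) xs) \<sigma>))"
  using assms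
proof (induction n arbitrary: k k' P \<sigma>)
  case 0
  then obtain F where F: "recursive_in X k F"
    "\<And>xs. length xs = k \<Longrightarrow> F xs = (if P xs then 1 else 0)" by auto
  have "recursive_in X k' (\<lambda>xs. F (map (\<lambda>G. G xs) (map (\<lambda>i xs. xs ! i) \<sigma>)))"
    using F(1) 0 by (intro recursive_in.comp) (auto intro: recursive_in.proj)
  then show ?case using F(2) 0(2) by (auto simp: comp_def)
next
  case (Suc n)
  then obtain Q where Q: "Sigma0_in X n (Suc k) Q"
    "\<And>xs. length xs = k \<Longrightarrow> P xs = (\<exists>y. \<not> Q (y # xs))" by auto
  have "Sigma0_in X n (Suc k') (\<lambda>ys. Q (map ((!) ys) (0 # map Suc \<sigma>)))"
    using Suc.prems by (intro Suc.IH[OF Q(1)]) auto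
  moreover have "P (map ((!) xs) \<sigma>) = (\<exists>y. \<not> Q (map ((!) (y # xs)) (0 # map Suc \<sigma>)))" for xs
    using Q(2)[of "map ((!) xs) \<sigma>"] Suc.prems by (simp add: comp_def)
  ultimately show ?case unfolding Sigma0_in.simps by blast
qed

section \<open>Primitive recursive reducibility and degrees\<close>

lemma PR_reducible_iff: "f \<le>PR g \<longleftrightarrow> pr {g} 1 (\<lambda>xs. f (xs ! 0))"
  unfolding PR_reducible_def pr_def by (auto simp: length_Suc_conv)

lemma primrec_in_oracle:
  assumes "primrec_in X k F" and X: "\<And>g. g \<in> X \<Longrightarrow> pr Y 1 (\<lambda>xs. g (xs ! 0))"
  shows "pr Y k F"
  using assms(1)
proof (induction rule: primrec_in.induct)
  case (comp Gs F k)
  have "prl Y k (length Gs) (\<lambda>xs. map (\<lambda>G. G xs) Gs)"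
    using comp.IH(2) by (auto simp: prl_def)
  from pr_comp[OF comp.IH(1) this] show ?case by simp
next
  case (prec k F G)
  have b: "pr Y (k + 1) (\<lambda>xs. F (tl xs))"
    by (rule pr_comp[OF prec.IH(1)]) (rule pr_intros | simp)+
  have "pr Y (k + 1 + 2) (\<lambda>zs. G (hd zs # hd (tl zs) # tl (tl (tl zs))))"
    by (rule pr_comp[OF prec.IH(2)]) (rule pr_intros | simp)+
  moreover have "pr Y (k + 1) (\<lambda>xs. hd xs)"
    by (rule pr_intros | simp)+
  ultimately show ?case
    using pr_rec[OF b, of "\<lambda>y r xs. G (y # r # tl xs)"] by simp
qed (rule X primrec_in_pr[OF primrec_in.zero] primrec_in_pr[OF primrec_in.succ] pr_proj; assumption)+

lemma pr_oracle:
  assumes "pr X k f" and "\<And>g. g \<in> X \<Longrightarrow> pr Y 1 (\<lambda>xs. g (xs ! 0))"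
  shows "pr Y k f"
proof -
  obtain F where "primrec_in X k F" "\<And>xs. length xs = k \<Longrightarrow> F xs = f xs"
    using assms(1) unfolding pr_def by blast
  then show ?thesis using pr_cong[OF primrec_in_oracle[OF _ assms(2)]] by metis
qed

lemma pr_mono: "pr {} k f \<Longrightarrow> pr X k f"
  by (rule pr_oracle) auto

lemma PR_reducible_refl: "f \<le>PR f"
  unfolding PR_reducible_def by (rule exI[of _ "\<lambda>xs. f (xs ! 0)"]) (simp add: primrec_in.basic del: One_nat_def)

lemma PR_reducible_trans: "f \<le>PR g \<Longrightarrow> g \<le>PR h \<Longrightarrow> f \<le>PR h"
  unfolding PR_reducible_iff by (rule pr_oracle) auto

text \<open>By transitivity any member of the degree serves as the single oracle, which removes the
  quantifier hidden in \<open>below_degree\<close>.\<close>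

lemma PR_degrees_generator:
  assumes "d \<in> PR_degrees"
  obtains g where "\<And>f. below_degree f d \<longleftrightarrow> f \<le>PR g"
proof -
  from assms obtain g where d: "d = {(f, g). f \<equiv>PR g} `` {g}"
    unfolding PR_degrees_def by (auto elim: quotientE)
  have "below_degree f d \<longleftrightarrow> f \<le>PR g" for f
    unfolding below_degree_def d PR_equiv_def
    using PR_reducible_refl PR_reducible_trans by auto
  then show thesis by (rule that)
qed

text \<open>\<open>E (s # xs)\<close> is the outcome of running the definition of \<open>F\<close> for \<open>s\<close> stages on \<open>xs\<close>, where \<open>0\<close>
  means that no value has been found yet.\<close>

lemma recursive_in_stages:
  assumes "recursive_in X k F"
  shows "\<exists>E. pr X (Suc k) E \<and> (\<forall>xs. length xs = k \<longrightarrow>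
    (\<forall>s. E (s # xs) = 0 \<or> E (s # xs) = Suc (F xs)) \<and>
    (\<forall>\<^sub>F s in sequentially. E (s # xs) = Suc (F xs)))"
  using assms
proof (induction rule: recursive_in.induct)
  case zero
  show ?case by (intro exI[of _ "\<lambda>_. 1"]) (simp add: pr_const)
next
  case succ
  have "pr X (Suc 1) (\<lambda>zs. Suc (Suc (zs ! 1)))" by (rule pr_intros | simp)+
  then show ?case by (intro exI[of _ "\<lambda>zs. Suc (Suc (zs ! 1))"]) simp
next
  case (proj i k)
  then have "pr X (Suc k) (\<lambda>zs. Suc (zs ! Suc i))" by (intro pr_Suc pr_proj) simp
  then show ?case by (intro exI[of _ "\<lambda>zs. Suc (zs ! Suc i)"]) simp
next
  case (basic g)
  have "pr X (Suc 1) (\<lambda>zs. Suc (g ([zs ! 1] ! 0)))"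
    by (rule pr_intros pr_comp[OF primrec_in_pr[OF primrec_in.basic[OF basic]]] | simp)+
  then show ?case by (intro exI[of _ "\<lambda>zs. Suc (g (zs ! 1))"]) simp
next
  case (comp Gs F k)
  obtain EF where EF: "pr X (Suc (length Gs)) EF"
    "\<And>s xs. length xs = length Gs \<Longrightarrow> EF (s # xs) = 0 \<or> EF (s # xs) = Suc (F xs)"
    "\<And>xs. length xs = length Gs \<Longrightarrow> \<forall>\<^sub>F s in sequentially. EF (s # xs) = Suc (F xs)"
    using comp.IH(1) by blast
  obtain e where e: "\<And>G. G \<in> set Gs \<Longrightarrow> pr X (Suc k) (e G)"
    "\<And>G s xs. G \<in> set Gs \<Longrightarrow> length xs = k \<Longrightarrow> e G (s # xs) = 0 \<or> e G (s # xs) = Suc (G xs)"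
    "\<And>G xs. G \<in> set Gs \<Longrightarrow> length xs = k \<Longrightarrow> \<forall>\<^sub>F s in sequentially. e G (s # xs) = Suc (G xs)"
    using comp.IH(2) by metis
  have P: "prP X (Suc k) (\<lambda>zs. \<forall>G\<in>set Hs. e G zs \<noteq> 0)" if "set Hs \<subseteq> set Gs" for Hs
    using that
  proof (induction Hs)
    case (Cons G Hs)
    then have "prP X (Suc k) (\<lambda>zs. e G zs \<noteq> 0 \<and> (\<forall>G\<in>set Hs. e G zs \<noteq> 0))"
      by (intro pr_intros e) auto
    then show ?case by simp
  qed (simp add: prP_const)
  \<comment> \<open>The outer function is started only when all inner ones have produced a value;
    subtracting 1 undoes the shift that reserves 0 for "no value yet".\<close>
  define E where "E = (\<lambda>zs. if \<forall>G\<in>set Gs. e G zs \<noteq> 0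
    then EF (hd zs # map (\<lambda>G. e G zs - 1) Gs) else 0)"
  have l: "prl X (Suc k) (length Gs) (\<lambda>zs. map (\<lambda>G. e G zs - 1) Gs)"
    using pr_pred[OF e(1)] by (auto simp: prl_def)
  have "pr X (Suc k) E"
    unfolding E_def by (rule P[OF subset_refl] pr_intros l pr_comp[OF EF(1)] | simp)+
  moreover have eq: "E (s # xs) = EF (s # map (\<lambda>G. G xs) Gs)"
    if "length xs = k" "\<forall>G\<in>set Gs. e G (s # xs) \<noteq> 0" for s xs
  proof -
    have "e G (s # xs) - 1 = G xs" if "G \<in> set Gs" for G
      using e(2)[OF that \<open>length xs = k\<close>, of s] \<open>\<forall>G\<in>set Gs. _\<close> that by auto
    then have "map (\<lambda>G. e G (s # xs) - 1) Gs = map (\<lambda>G. G xs) Gs" by simp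
    then show ?thesis by (simp only: E_def if_P[OF that(2)] list.sel)
  qed
  moreover have "E (s # xs) = 0 \<or> E (s # xs) = Suc (F (map (\<lambda>G. G xs) Gs))"
    if "length xs = k" for s xs
  proof (cases "\<forall>G\<in>set Gs. e G (s # xs) \<noteq> 0")
    case True
    from eq[OF that this] show ?thesis using EF(2)[of "map (\<lambda>G. G xs) Gs" s] by simp
  next
    case False
    then show ?thesis unfolding E_def by presburger
  qed
  moreover have "\<forall>\<^sub>F s in sequentially. E (s # xs) = Suc (F (map (\<lambda>G. G xs) Gs))"
    if "length xs = k" for xs
  proof -
    have "\<forall>\<^sub>F s in sequentially. \<forall>G\<in>set Gs. e G (s # xs) = Suc (G xs)"
      using e(3) that by (intro eventually_ball_finite) auto
    moreover have "\<forall>\<^sub>F s in sequentially. EF (s # map (\<lambda>G. G xs) Gs) = Suc (F (map (\<lambda>G. G xs) Gs))"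
      by (intro EF(3)) simp
    ultimately show ?thesis
      by eventually_elim (use eq[OF that] in simp)
  qed
  ultimately show ?case by blast
next
  case (prec k F G)
  obtain EF where EF: "pr X (Suc k) EF"
    "\<And>s xs. length xs = k \<Longrightarrow> EF (s # xs) = 0 \<or> EF (s # xs) = Suc (F xs)"
    "\<And>xs. length xs = k \<Longrightarrow> \<forall>\<^sub>F s in sequentially. EF (s # xs) = Suc (F xs)"
    using prec.IH(1) by blast
  obtain EG where EG: "pr X (Suc (k + 2)) EG"
    "\<And>s xs. length xs = k + 2 \<Longrightarrow> EG (s # xs) = 0 \<or> EG (s # xs) = Suc (G xs)"
    "\<And>xs. length xs = k + 2 \<Longrightarrow> \<forall>\<^sub>F s in sequentially. EG (s # xs) = Suc (G xs)"
    using prec.IH(2) by blast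
  define R where "R = (\<lambda>n ys. rec_nat (F ys) (\<lambda>y r. G (y # r # ys)) n)"
  \<comment> \<open>The case \<open>r = 0\<close> passes on that some earlier step of the recursion
    has not produced a value yet.\<close>
  define E where "E = (\<lambda>n s ys. rec_nat (EF (s # ys))
      (\<lambda>y r. if r = 0 then 0 else EG (s # y # (r - 1) # ys)) n)"
  have pE: "pr X (Suc (k + 1)) (\<lambda>zs. E (hd (tl zs)) (hd zs) (tl (tl zs)))"
    unfolding E_def
    by (rule pr_rec pr_intros pr_comp[OF EF(1)] pr_comp[OF EG(1)] | simp)+
  have E1: "E n s ys = 0 \<or> E n s ys = Suc (R n ys)" if "length ys = k" for n s ys
  proof (induction n)
    case 0
    then show ?case using EF(2)[OF that] by (simp add: E_def R_def)
  next
    case (Suc n)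
    then show ?case using EG(2)[of "n # R n ys # ys" s] that by (auto simp: E_def R_def)
  qed
  have E2: "\<forall>\<^sub>F s in sequentially. E n s ys = Suc (R n ys)" if "length ys = k" for n ys
  proof (induction n)
    case 0
    then show ?case using EF(3)[OF that] by (simp add: E_def R_def)
  next
    case (Suc n)
    have "\<forall>\<^sub>F s in sequentially. EG (s # n # R n ys # ys) = Suc (G (n # R n ys # ys))"
      using that by (intro EG(3)) simp
    with Suc.IH show ?case by eventually_elim (simp add: E_def R_def)
  qed
  show ?case
  proof (intro exI[of _ "\<lambda>zs. E (hd (tl zs)) (hd zs) (tl (tl zs))"] conjI allI impI)
    fix xs :: "nat list"
    assume "length xs = k + 1"
    then have "length (tl xs) = k" by simp
    from E1[OF this, of "hd xs"] E2[OF this, of "hd xs"]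
    show "E (hd (tl (s # xs))) (hd (s # xs)) (tl (tl (s # xs))) = 0 \<or>
        E (hd (tl (s # xs))) (hd (s # xs)) (tl (tl (s # xs))) =
          Suc (rec_nat (F (tl xs)) (\<lambda>y r. G (y # r # tl xs)) (hd xs))"
      and "\<forall>\<^sub>F s in sequentially. E (hd (tl (s # xs))) (hd (s # xs)) (tl (tl (s # xs))) =
          Suc (rec_nat (F (tl xs)) (\<lambda>y r. G (y # r # tl xs)) (hd xs))" for s
      by (auto simp: R_def)
  qed (use pE in simp)
next
  case (mu k F)
  obtain EF where EF: "pr X (Suc (k + 1)) EF"
    "\<And>s xs. length xs = k + 1 \<Longrightarrow> EF (s # xs) = 0 \<or> EF (s # xs) = Suc (F xs)"
    "\<And>xs. length xs = k + 1 \<Longrightarrow> \<forall>\<^sub>F s in sequentially. EF (s # xs) = Suc (F xs)"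
    using mu.IH by blast
  \<comment> \<open>The search stops at the first \<open>y\<close> that is a confirmed zero (outcome
    1) or still undecided (outcome 0). \<open>E\<close> answers only in the former case, when all
    smaller arguments are known not to be zeros.\<close>
  define l where "l = (\<lambda>zs. LEAST y. EF (hd zs # y # tl zs) \<le> 1 \<or> hd zs \<le> y)"
  define E where "E = (\<lambda>zs. if EF (hd zs # l zs # tl zs) = 1 then Suc (l zs) else 0)"
  have pl: "pr X (Suc k) l"
    unfolding l_def by (rule pr_intros pr_comp[OF EF(1)] | simp)+
  have pE: "pr X (Suc k) E"
    unfolding E_def by (rule pr_intros pr_comp[OF EF(1)] pl | simp)+
  have E1: "E (s # xs) = 0 \<or> E (s # xs) = Suc (LEAST y. F (y # xs) = 0)"
    if len: "length xs = k" for s xs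
  proof (cases "EF (s # l (s # xs) # xs) = 1")
    case True
    have "(LEAST y. F (y # xs) = 0) = l (s # xs)"
    proof (rule Least_equality)
      show "F (l (s # xs) # xs) = 0" using True EF(2)[of "l (s # xs) # xs" s] len by auto
      fix y assume y: "F (y # xs) = 0"
      have "EF (s # y # xs) \<le> 1" using EF(2)[of "y # xs" s] y len by auto
      then show "l (s # xs) \<le> y" unfolding l_def by (intro Least_le) simp
    qed
    then show ?thesis by (simp add: E_def)
  qed (simp add: E_def)
  have E2: "\<forall>\<^sub>F s in sequentially. E (s # xs) = Suc (LEAST y. F (y # xs) = 0)"
    if len: "length xs = k" for xs
  proof -
    define m where "m = (LEAST y. F (y # xs) = 0)"
    have m: "F (m # xs) = 0" "\<And>y. y < m \<Longrightarrow> F (y # xs) \<noteq> 0"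
      using LeastI_ex[OF mu.hyps(2)[OF len]] not_less_Least unfolding m_def by blast+
    have "\<forall>\<^sub>F s in sequentially. \<forall>y\<in>{..m}. EF (s # y # xs) = Suc (F (y # xs))"
      using len by (intro eventually_ball_finite) (auto intro: EF(3))
    moreover have "\<forall>\<^sub>F s in sequentially. m < s" by (rule eventually_gt_at_top)
    ultimately have "\<forall>\<^sub>F s in sequentially. E (s # xs) = Suc m"
    proof eventually_elim
      case (elim s)
      have "l (s # xs) = m"
        unfolding l_def
      proof (rule Least_equality)
        show "EF (hd (s # xs) # m # tl (s # xs)) \<le> 1 \<or> hd (s # xs) \<le> m"
          using elim m by simp
        show "m \<le> y" if "EF (hd (s # xs) # y # tl (s # xs)) \<le> 1 \<or> hd (s # xs) \<le> y" for y
        proof (rule ccontr)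
          assume "\<not> m \<le> y"
          then show False using elim m(2)[of y] that by auto
        qed
      qed
      then show ?case using elim m by (simp add: E_def)
    qed
    then show ?thesis by (simp add: m_def)
  qed
  show ?case using pE E1 E2 by blast
qed

text \<open>Level 0 of the hierarchy is recursive, but the coding below needs a primitive recursive
  matrix. The stage needed to evaluate the recursive matrix is absorbed by the innermost existential
  quantifier.\<close>

lemma Sigma0_in_3_normal_form:
  assumes "Sigma0_in X 3 k P"
  shows "\<exists>R. prP X (k + 3) R \<and>
    (\<forall>xs. length xs = k \<longrightarrow> P xs = (\<exists>y. \<forall>z. \<exists>w. R (w # z # y # xs)))"
proof -
  obtain Q2 where Q2: "Sigma0_in X 2 (Suc k) Q2"
      "\<And>xs. length xs = k \<Longrightarrow> P xs = (\<exists>y. \<not> Q2 (y # xs))"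
    using assms by (auto simp: numeral_3_eq_3 numeral_2_eq_2)
  then obtain Q1 where Q1: "Sigma0_in X 1 (Suc (Suc k)) Q1"
      "\<And>xs. length xs = Suc k \<Longrightarrow> Q2 xs = (\<exists>y. \<not> Q1 (y # xs))"
    by (auto simp: numeral_2_eq_2)
  then obtain Q0 F where Q0: "recursive_in X (k + 3) F"
      "\<And>xs. length xs = k + 3 \<Longrightarrow> F xs = (if Q0 xs then 1 else 0)"
      "\<And>xs. length xs = Suc (Suc k) \<Longrightarrow> Q1 xs = (\<exists>y. \<not> Q0 (y # xs))"
    by (auto simp: numeral_3_eq_3)
  obtain E where E: "pr X (Suc (k + 3)) E"
    "\<And>s xs. length xs = k + 3 \<Longrightarrow> E (s # xs) = 0 \<or> E (s # xs) = Suc (F xs)"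
    "\<And>xs. length xs = k + 3 \<Longrightarrow> \<forall>\<^sub>F s in sequentially. E (s # xs) = Suc (F xs)"
    using recursive_in_stages[OF Q0(1)] by blast
  \<comment> \<open>The new witness is a stage that also bounds the original witness
    \<open>w\<close>. Outcome 1 means that \<open>F\<close> has the value 0, that is,
    \<open>Q0\<close> fails.\<close>
  define R where "R = (\<lambda>zs. \<exists>w<hd zs. E (hd zs # w # tl zs) = 1)"
  have R: "(\<exists>s. R (s # ys)) \<longleftrightarrow> (\<exists>w. \<not> Q0 (w # ys))" if "length ys = k + 2" for ys
  proof
    assume "\<exists>s. R (s # ys)"
    then obtain s w where "E (s # w # ys) = 1" by (auto simp: R_def)
    then show "\<exists>w. \<not> Q0 (w # ys)"
      using E(2)[of "w # ys" s] Q0(2)[of "w # ys"] that by (auto split: if_splits)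
  next
    assume "\<exists>w. \<not> Q0 (w # ys)"
    then obtain w where w: "\<not> Q0 (w # ys)" by blast
    have "\<forall>\<^sub>F s in sequentially. E (s # w # ys) = Suc (F (w # ys)) \<and> w < s"
      using that by (intro eventually_conj E(3) eventually_gt_at_top) simp
    then obtain s where "E (s # w # ys) = Suc (F (w # ys))" "w < s"
      by (auto simp: eventually_sequentially)
    then have "R (s # ys)" using w Q0(2)[of "w # ys"] that by (auto simp: R_def)
    then show "\<exists>s. R (s # ys)" ..
  qed
  have "prP X (k + 3) R"
    unfolding R_def by (rule pr_intros pr_comp[OF E(1)] | simp)+
  moreover have "P xs = (\<exists>y. \<forall>z. \<exists>w. R (w # z # y # xs))" if "length xs = k" for xs
    using that by (simp add: Q2(2) Q1(2) Q0(3) R)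
  ultimately show ?thesis by blast
qed



section \<open>Limits of primitive recursive functions\<close>

text \<open>In the spirit of the limit lemma, \<open>\<Delta>\<^sup>0\<^sub>2\<close> functions are
  handled as limits: closure properties are easier to obtain for limits than for pairs of quantifier
  forms.\<close>

definition limit_pr :: "(nat \<Rightarrow> nat) set \<Rightarrow> nat \<Rightarrow> (nat list \<Rightarrow> nat) \<Rightarrow> bool" where
  "limit_pr X k f \<longleftrightarrow> (\<exists>E. pr X (Suc k) E \<and>
     (\<forall>xs. length xs = k \<longrightarrow> (\<forall>\<^sub>F s in sequentially. E (s # xs) = f xs)))"

definition limit_prl :: "(nat \<Rightarrow> nat) set \<Rightarrow> nat \<Rightarrow> nat \<Rightarrow> (nat list \<Rightarrow> nat list) \<Rightarrow> bool" where
  "limit_prl X k m \<phi> \<longleftrightarrow>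
     (\<forall>xs. length xs = k \<longrightarrow> length (\<phi> xs) = m) \<and> (\<forall>i<m. limit_pr X k (\<lambda>xs. \<phi> xs ! i))"

definition limit_prP :: "(nat \<Rightarrow> nat) set \<Rightarrow> nat \<Rightarrow> (nat list \<Rightarrow> bool) \<Rightarrow> bool" where
  "limit_prP X k P \<longleftrightarrow> limit_pr X k (\<lambda>xs. of_bool (P xs))"

named_theorems limit_intros

lemma limit_pr_cong:
  assumes "limit_pr X k g" and "\<And>xs. length xs = k \<Longrightarrow> f xs = g xs"
  shows "limit_pr X k f"
  using assms unfolding limit_pr_def by metis

lemma limit_prP_cong:
  assumes "limit_prP X k Q" and "\<And>xs. length xs = k \<Longrightarrow> P xs = Q xs"
  shows "limit_prP X k P"
  using assms(1) unfolding limit_prP_def by (rule limit_pr_cong) (simp add: assms(2))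

lemma pr_limit_pr:
  assumes "pr X k f" shows "limit_pr X k f"
proof -
  have "pr X (Suc k) (\<lambda>zs. f (tl zs))"
    by (rule pr_comp[OF assms]) (rule pr_intros | simp)+
  then show ?thesis unfolding limit_pr_def by (intro exI[of _ "\<lambda>zs. f (tl zs)"]) simp
qed

lemma prP_limit_prP: "prP X k P \<Longrightarrow> limit_prP X k P"
  unfolding prP_def limit_prP_def by (rule pr_limit_pr)

lemma limit_pr_comp:
  assumes G: "limit_pr X m G" and p: "limit_prl X k m' \<phi>" and m: "m' = m"
  shows "limit_pr X k (\<lambda>xs. G (\<phi> xs))"
proof -
  obtain EG where EG: "pr X (Suc m) EG"
    "\<And>xs. length xs = m \<Longrightarrow> \<forall>\<^sub>F s in sequentially. EG (s # xs) = G xs"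
    using G unfolding limit_pr_def by blast
  have "\<forall>i<m. \<exists>E. pr X (Suc k) E \<and>
      (\<forall>xs. length xs = k \<longrightarrow> (\<forall>\<^sub>F s in sequentially. E (s # xs) = \<phi> xs ! i))"
    using p m unfolding limit_prl_def limit_pr_def by blast
  then obtain e where e: "\<And>i. i < m \<Longrightarrow> pr X (Suc k) (e i)"
    "\<And>i xs. i < m \<Longrightarrow> length xs = k \<Longrightarrow> \<forall>\<^sub>F s in sequentially. e i (s # xs) = \<phi> xs ! i"
    by metis
  define E where "E = (\<lambda>zs. EG (hd zs # map (\<lambda>i. e i zs) [0..<m]))"
  have l: "prl X (Suc k) m (\<lambda>zs. map (\<lambda>i. e i zs) [0..<m])"
    using e(1) by (simp add: prl_def)
  have "pr X (Suc k) E"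
    unfolding E_def by (rule pr_intros l pr_comp[OF EG(1)] | simp)+
  moreover have "\<forall>\<^sub>F s in sequentially. E (s # xs) = G (\<phi> xs)" if len: "length xs = k" for xs
  proof -
    have lp: "length (\<phi> xs) = m" using p m len by (simp add: limit_prl_def)
    have "\<forall>\<^sub>F s in sequentially. \<forall>i\<in>{..<m}. e i (s # xs) = \<phi> xs ! i"
      using e(2) len by (intro eventually_ball_finite) auto
    with EG(2)[OF lp] show ?thesis
    proof eventually_elim
      case (elim s)
      then have "map (\<lambda>i. e i (s # xs)) [0..<m] = \<phi> xs"
        using lp by (intro nth_equalityI) auto
      then show ?case using elim by (simp add: E_def)
    qed
  qed
  ultimately show ?thesis unfolding limit_pr_def by blast
qed

lemma limit_prP_comp:
  assumes "limit_prP X m P" "limit_prl X k m' \<phi>" "m' = m"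
  shows "limit_prP X k (\<lambda>xs. P (\<phi> xs))"
  using limit_pr_comp[OF assms(1)[unfolded limit_prP_def] assms(2,3)] by (simp add: limit_prP_def)

lemma limit_prl_Nil [limit_intros]: "limit_prl X k 0 (\<lambda>xs. [])"
  by (simp add: limit_prl_def)

lemma limit_prl_Cons [limit_intros]:
  assumes "limit_pr X k f" and "limit_prl X k m \<phi>"
  shows "limit_prl X k (Suc m) (\<lambda>xs. f xs # \<phi> xs)"
  using assms by (auto simp: limit_prl_def less_Suc_eq_0_disj)

lemma limit_pr_nth [limit_intros]: "i < k \<Longrightarrow> limit_pr X k (\<lambda>xs. xs ! i)"
  by (intro pr_limit_pr pr_proj)

lemma limit_pr_const [limit_intros]: "limit_pr X k (\<lambda>xs. c)"
  by (intro pr_limit_pr pr_const)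

lemma limit_pr_hd [limit_intros]: "limit_pr X (Suc k) (\<lambda>xs. hd xs)"
  by (intro pr_limit_pr) (rule pr_intros | simp)+

lemma limit_pr_nth_tl [limit_intros]: "i < k \<Longrightarrow> limit_pr X (Suc k) (\<lambda>xs. tl xs ! i)"
  by (intro pr_limit_pr) (rule pr_intros | simp)+

lemma limit_prP_not [limit_intros]:
  assumes "limit_prP X k P" shows "limit_prP X k (\<lambda>xs. \<not> P xs)"
proof -
  have "limit_pr X 1 (\<lambda>ys. 1 - hd ys)" by (rule pr_limit_pr) (rule pr_intros | simp)+
  from limit_pr_comp[OF this limit_prl_Cons[OF assms[unfolded limit_prP_def] limit_prl_Nil]]
  show ?thesis unfolding limit_prP_def by (rule limit_pr_cong) simp_all
qed

lemma limit_prP_conj [limit_intros]: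
  assumes "limit_prP X k P" "limit_prP X k Q" shows "limit_prP X k (\<lambda>xs. P xs \<and> Q xs)"
proof -
  have "limit_pr X 2 (\<lambda>ys. hd ys * hd (tl ys))" by (rule pr_limit_pr) (rule pr_intros | simp)+
  from limit_pr_comp[OF this limit_prl_Cons[OF assms(1)[unfolded limit_prP_def]
        limit_prl_Cons[OF assms(2)[unfolded limit_prP_def] limit_prl_Nil]]]
  show ?thesis unfolding limit_prP_def by (rule limit_pr_cong) simp_all
qed

lemma limit_prP_disj [limit_intros]:
  assumes "limit_prP X k P" "limit_prP X k Q" shows "limit_prP X k (\<lambda>xs. P xs \<or> Q xs)"
  by (rule limit_prP_cong[OF limit_prP_not[OF limit_prP_conj[OF
          limit_prP_not[OF assms(1)] limit_prP_not[OF assms(2)]]]]) simp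

lemma limit_prP_imp [limit_intros]:
  assumes "limit_prP X k P" "limit_prP X k Q" shows "limit_prP X k (\<lambda>xs. P xs \<longrightarrow> Q xs)"
  by (rule limit_prP_cong[OF limit_prP_disj[OF limit_prP_not[OF assms(1)] assms(2)]]) simp

lemma limit_prP_eq [limit_intros]:
  assumes "limit_pr X k f" "limit_pr X k g" shows "limit_prP X k (\<lambda>xs. f xs = g xs)"
proof -
  have "limit_prP X 2 (\<lambda>ys. hd ys = hd (tl ys))" by (rule prP_limit_prP) (rule pr_intros | simp)+
  from limit_prP_comp[OF this limit_prl_Cons[OF assms(1) limit_prl_Cons[OF assms(2) limit_prl_Nil]]]
  show ?thesis by simp
qed

lemma limit_pr_Suc [limit_intros]:
  assumes "limit_pr X k f" shows "limit_pr X k (\<lambda>xs. Suc (f xs))"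
proof -
  have "limit_pr X 1 (\<lambda>ys. Suc (hd ys))" by (rule pr_limit_pr) (rule pr_intros | simp)+
  from limit_pr_comp[OF this limit_prl_Cons[OF assms limit_prl_Nil]] show ?thesis by simp
qed

lemma limit_pr_if [limit_intros]:
  assumes "limit_prP X k P" "limit_pr X k f" "limit_pr X k g"
  shows "limit_pr X k (\<lambda>xs. if P xs then f xs else g xs)"
proof -
  have "limit_pr X 3 (\<lambda>ys. if hd ys = 1 then hd (tl ys) else hd (tl (tl ys)))"
    by (rule pr_limit_pr) (rule pr_intros | simp)+
  from limit_pr_comp[OF this limit_prl_Cons[OF assms(1)[unfolded limit_prP_def]
        limit_prl_Cons[OF assms(2) limit_prl_Cons[OF assms(3) limit_prl_Nil]]]]
  show ?thesis by (rule limit_pr_cong) simp_all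
qed

text \<open>A search below the stage changes its verdict at most once.\<close>

lemma limit_prP_ex:
  assumes "prP X (Suc k) (\<lambda>ys. P (hd ys) (tl ys))"
  shows "limit_prP X k (\<lambda>xs. \<exists>y. P y xs)"
  unfolding limit_prP_def limit_pr_def
proof (intro exI conjI allI impI)
  have "prP X (Suc (Suc k)) (\<lambda>ys. P (hd (hd ys # tl (tl ys))) (tl (hd ys # tl (tl ys))))"
    by (rule prP_comp[OF assms]) (rule pr_intros | simp)+
  then have "prP X (Suc (Suc k)) (\<lambda>ys. P (hd ys) (tl (tl ys)))" by simp
  then have "prP X (Suc k) (\<lambda>zs. \<exists>y<hd zs. P y (tl zs))"
    by (intro prP_bex) (rule pr_intros | simp)+
  then show "pr X (Suc k) (\<lambda>zs. of_bool (\<exists>y<hd zs. P y (tl zs)))" by (simp add: prP_def)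
  show "\<forall>\<^sub>F s in sequentially. of_bool (\<exists>y<hd (s # xs). P y (tl (s # xs)))
      = (of_bool (\<exists>y. P y xs) :: nat)" for xs
  proof (cases "\<exists>y. P y xs")
    case True
    then obtain y where y: "P y xs" ..
    from eventually_gt_at_top[of y] show ?thesis
      by eventually_elim (use y in auto)
  qed simp
qed

text \<open>Only the finitely many arguments up to the minimum have to settle. Existence of a
  witness makes that minimum a fixed bound which the stage eventually exceeds.\<close>

lemma limit_pr_Least:
  assumes P: "limit_prP X (Suc k) (\<lambda>ys. P (hd ys) (tl ys))"
    and ex: "\<And>xs. length xs = k \<Longrightarrow> \<exists>y. P y xs"
  shows "limit_pr X k (\<lambda>xs. LEAST y. P y xs)"
proof -
  obtain E where E: "pr X (Suc (Suc k)) E"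
    "\<And>xs. length xs = Suc k \<Longrightarrow>
      \<forall>\<^sub>F s in sequentially. E (s # xs) = of_bool (P (hd xs) (tl xs))"
    using P unfolding limit_pr_def limit_prP_def by blast
  show ?thesis
    unfolding limit_pr_def
  proof (intro exI conjI allI impI)
    show "pr X (Suc k) (\<lambda>zs. LEAST y. E (hd zs # y # tl zs) = 1 \<or> hd zs \<le> y)"
      by (rule pr_intros pr_comp[OF E(1)] | simp)+
    fix xs :: "nat list"
    assume len: "length xs = k"
    define m where "m = (LEAST y. P y xs)"
    have m: "P m xs" "\<And>y. y < m \<Longrightarrow> \<not> P y xs"
      using LeastI_ex[OF ex[OF len]] not_less_Least unfolding m_def by blast+
    have "\<forall>\<^sub>F s in sequentially. E (s # y # xs) = of_bool (P y xs)" for y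
      using E(2)[of "y # xs"] len by simp
    then have "\<forall>\<^sub>F s in sequentially. \<forall>y\<in>{..m}. E (s # y # xs) = of_bool (P y xs)"
      by (intro eventually_ball_finite) auto
    with eventually_gt_at_top[of m]
    show "\<forall>\<^sub>F s in sequentially.
      (LEAST y. E (hd (s # xs) # y # tl (s # xs)) = 1 \<or> hd (s # xs) \<le> y) = (LEAST y. P y xs)"
      unfolding m_def[symmetric]
    proof eventually_elim
      case (elim s)
      show ?case
      proof (rule Least_equality)
        show "E (hd (s # xs) # m # tl (s # xs)) = 1 \<or> hd (s # xs) \<le> m" using elim m by simp
        show "m \<le> y" if "E (hd (s # xs) # y # tl (s # xs)) = 1 \<or> hd (s # xs) \<le> y" for y
        proof (rule ccontr)
          assume "\<not> m \<le> y"
          then show False using elim m(2)[of y] that by auto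
        qed
      qed
    qed
  qed
qed

lemma limit_pr_card:
  assumes P: "limit_prP X (Suc k) (\<lambda>ys. P (hd ys) (tl ys))" and b: "limit_pr X k b"
  shows "limit_pr X k (\<lambda>xs. card {y. y < b xs \<and> P y xs})"
proof -
  obtain E where E: "pr X (Suc (Suc k)) E"
    "\<And>xs. length xs = Suc k \<Longrightarrow>
      \<forall>\<^sub>F s in sequentially. E (s # xs) = of_bool (P (hd xs) (tl xs))"
    using P unfolding limit_pr_def limit_prP_def by blast
  obtain Eb where Eb: "pr X (Suc k) Eb"
    "\<And>xs. length xs = k \<Longrightarrow> \<forall>\<^sub>F s in sequentially. Eb (s # xs) = b xs"
    using b unfolding limit_pr_def by blast
  show ?thesis
    unfolding limit_pr_def
  proof (intro exI conjI allI impI)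
    show "pr X (Suc k) (\<lambda>zs. rec_nat 0 (\<lambda>y r. E (hd zs # y # tl zs) + r) (Eb zs))"
      by (rule pr_rec pr_intros pr_comp[OF E(1)] Eb(1) | simp)+
    fix xs :: "nat list"
    assume len: "length xs = k"
    have c: "rec_nat 0 (\<lambda>y r. of_bool (P y xs) + r) n = card {y. y < n \<and> P y xs}" for n
    proof (induction n)
      case (Suc n)
      have "{y. y < Suc n \<and> P y xs} = {y. y < n \<and> P y xs} \<union> (if P n xs then {n} else {})"
        by (auto simp: less_Suc_eq)
      then show ?case using Suc by simp
    qed simp
    have "\<forall>\<^sub>F s in sequentially. E (s # y # xs) = of_bool (P y xs)" for y
      using E(2)[of "y # xs"] len by simp
    then have "\<forall>\<^sub>F s in sequentially. \<forall>y\<in>{..b xs}. E (s # y # xs) = of_bool (P y xs)"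
      by (intro eventually_ball_finite) auto
    with Eb(2)[OF len]
    show "\<forall>\<^sub>F s in sequentially. rec_nat 0 (\<lambda>y r. E (hd (s # xs) # y # tl (s # xs)) + r)
      (Eb (s # xs)) = card {y. y < b xs \<and> P y xs}"
    proof eventually_elim
      case (elim s)
      have "n \<le> b xs \<Longrightarrow> rec_nat 0 (\<lambda>y r. E (s # y # xs) + r) n
          = rec_nat 0 (\<lambda>y r. of_bool (P y xs) + r) n" for n
        using elim(2) by (induction n) auto
      then show ?case using elim(1) by (simp add: c)
    qed
  qed
qed

lemma Sigma0_in_2I:
  assumes "prP X (k + 2) R" and "\<And>xs. length xs = k \<Longrightarrow> P xs = (\<exists>s. \<forall>t. R (t # s # xs))"
  shows "Sigma0_in X 2 k P"
proof -
  obtain F where F: "primrec_in X (k + 2) F" "\<And>xs. length xs = k + 2 \<Longrightarrow> F xs = of_bool (R xs)"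
    using assms(1) unfolding prP_def pr_def by blast
  have "Sigma0_in X 0 (Suc (Suc k)) R"
    using primrec_in_recursive_in[OF F(1)] F(2) by auto
  then have "Sigma0_in X (Suc 0) (Suc k) (\<lambda>ys. \<exists>t. \<not> R (t # ys))"
    unfolding Sigma0_in.simps(2) by blast
  moreover have "\<forall>xs. length xs = k \<longrightarrow> P xs = (\<exists>s. \<not> (\<exists>t. \<not> R (t # s # xs)))"
    using assms(2) by simp
  ultimately show ?thesis unfolding numeral_2_eq_2 Sigma0_in.simps(2)[of _ "Suc 0"] by blast
qed

text \<open>Any property of the limit value can be expressed as "from some stage on", a
  \<open>\<Sigma>\<^sup>0\<^sub>2\<close> form; this is applied both to the graph and to its
  complement.\<close>

lemma limit_pr_Delta0_fun_in:
  assumes "limit_pr X 1 (\<lambda>xs. f (xs ! 0))"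
  shows "Delta0_fun_in X 2 f"
proof -
  obtain E where "pr X (Suc 1) E"
    "\<forall>xs. length xs = 1 \<longrightarrow> (\<forall>\<^sub>F s in sequentially. E (s # xs) = f (xs ! 0))"
    using assms unfolding limit_pr_def by blast
  then have E: "pr X 2 E" "\<forall>\<^sub>F s in sequentially. E [s, x] = f x" for x
    by (auto simp: numeral_2_eq_2 dest: spec[of _ "[x]"])
  have ex: "(\<exists>s. \<forall>t. t < s \<or> Q (E [t, x])) \<longleftrightarrow> Q (f x)" for x and Q :: "nat \<Rightarrow> bool"
  proof -
    have "(\<exists>s. \<forall>t. t < s \<or> Q (E [t, x])) \<longleftrightarrow> (\<forall>\<^sub>F t in sequentially. Q (E [t, x]))"
      by (simp add: eventually_sequentially flip: not_le imp_conv_disj)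
    also have "\<dots> \<longleftrightarrow> (\<forall>\<^sub>F t in sequentially. Q (f x))"
      by (rule eventually_cong[OF E(2)[of x]]) simp
    finally show ?thesis by simp
  qed
  have 1: "Sigma0_in X 2 2 (\<lambda>xs. f (xs ! 0) = xs ! 1)"
  proof (rule Sigma0_in_2I)
    show "prP X (2 + 2) (\<lambda>zs. zs ! 0 < zs ! 1 \<or> E [zs ! 0, zs ! 2] = zs ! 3)"
      by (rule pr_intros pr_comp[OF E(1)] | simp)+
    show "(f (xs ! 0) = xs ! 1) = (\<exists>s. \<forall>t. (t # s # xs) ! 0 < (t # s # xs) ! 1 \<or>
        E [(t # s # xs) ! 0, (t # s # xs) ! 2] = (t # s # xs) ! 3)" if "length xs = 2" for xs
      using ex[where x = "xs ! 0" and Q = "\<lambda>y. y = xs ! 1"] by simp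
  qed
  have 2: "Sigma0_in X 2 2 (\<lambda>xs. f (xs ! 0) \<noteq> xs ! 1)"
  proof (rule Sigma0_in_2I)
    show "prP X (2 + 2) (\<lambda>zs. zs ! 0 < zs ! 1 \<or> E [zs ! 0, zs ! 2] \<noteq> zs ! 3)"
      by (rule pr_intros pr_comp[OF E(1)] | simp)+
    show "(f (xs ! 0) \<noteq> xs ! 1) = (\<exists>s. \<forall>t. (t # s # xs) ! 0 < (t # s # xs) ! 1 \<or>
        E [(t # s # xs) ! 0, (t # s # xs) ! 2] \<noteq> (t # s # xs) ! 3)" if "length xs = 2" for xs
      using ex[where x = "xs ! 0" and Q = "\<lambda>y. y \<noteq> xs ! 1"] by simp
  qed
  from 1 2 show ?thesis by (simp add: Delta0_fun_in_def Delta0_in_def Pi0_in_def)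
qed


section \<open>Atomic diagrams and the cone\<close>

lemma punctual_iff: "punctual A \<longleftrightarrow> pr {} 1 (\<lambda>xs. A (xs ! 0))"
  unfolding punctual_def pr_def by (auto simp: length_Suc_conv)

text \<open>Common ground for the punctual \<open>A\<close> and an arbitrary \<open>B\<close> with
  its atomic diagram as oracle. The map \<open>B\<close> itself need not be primitive recursive in
  the diagram, as its values must be searched for; equations between iterates are.\<close>

definition pr_equations :: "(nat \<Rightarrow> nat) set \<Rightarrow> (nat \<Rightarrow> nat) \<Rightarrow> bool" where
  "pr_equations X A \<longleftrightarrow> prP X 4 (\<lambda>xs. (A ^^ (xs ! 0)) (xs ! 1) = (A ^^ (xs ! 2)) (xs ! 3))"

lemma pr_equations_punctual:
  assumes "punctual A" shows "pr_equations X A"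
proof -
  have "pr X 1 (\<lambda>xs. A (xs ! 0))" using assms by (simp add: punctual_iff pr_mono)
  then show ?thesis
    unfolding pr_equations_def by (intro prP_eq pr_funpow) (rule pr_intros | simp)+
qed

lemma pr_char_fun_atomic_diagram:
  assumes "punctual B"
  shows "pr {} 1 (\<lambda>xs. char_fun (atomic_diagram B) (xs ! 0))"
proof -
  \<comment> \<open>\<open>c\<close> and \<open>n\<close> are head and tail of a coded list;
    \<open>list_encode\<close> adds 1 to the code of a nonempty list, hence \<open>z - 1\<close>.
    Encoding the five decoded entries again rejects numbers that do not code lists of length
    5.\<close>
  define c where "c = (\<lambda>z. fst (prod_decode (z - 1)))"
  define n where "n = (\<lambda>z. snd (prod_decode (z - 1)))"
  have cn: "c (list_encode (a # as)) = a" "n (list_encode (a # as)) = list_encode as" for a as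
    by (simp_all add: c_def n_def)
  have cp [pr_intros]: "pr {} k (\<lambda>xs. c (f xs))" "pr {} k (\<lambda>xs. n (f xs))"
    if "pr {} k f" for k f
    unfolding c_def n_def by (rule pr_intros that)+
  define D where "D = (\<lambda>z. (B ^^ c (n z)) (c (n (n z))) = (B ^^ c (n (n (n z)))) (c (n (n (n (n z))))))"
  have "pr {} 1 (\<lambda>xs. B (xs ! 0))" using assms by (simp add: punctual_iff)
  then have D [pr_intros]: "prP {} 1 (\<lambda>xs. D (xs ! 0))"
    unfolding D_def by (intro prP_eq pr_funpow) (rule pr_intros | simp)+
  have "z \<in> atomic_diagram B \<longleftrightarrow>
    z = list_encode [c z, c (n z), c (n (n z)), c (n (n (n z))), c (n (n (n (n z))))] \<and>
    (c z = 1 \<and> D z \<or> c z = 0 \<and> \<not> D z)" (is "?l z \<longleftrightarrow> ?r z") for z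
  proof
    show "?r z" if "?l z"
      using that unfolding atomic_diagram_def
      by (elim UnE CollectE exE conjE) (simp_all only: cn D_def, simp_all)
    show "?l z" if "?r z"
      using that unfolding atomic_diagram_def D_def by (elim conjE disjE) auto
  qed
  then have "char_fun (atomic_diagram B) z = of_bool
    (z = list_encode [c z, c (n z), c (n (n z)), c (n (n (n z))), c (n (n (n (n z))))] \<and>
    (c z = 1 \<and> D z \<or> c z = 0 \<and> \<not> D z))" for z
    unfolding char_fun_def of_bool_def by presburger
  moreover have "prP {} 1 (\<lambda>xs. xs ! 0 = list_encode [c (xs ! 0), c (n (xs ! 0)),
      c (n (n (xs ! 0))), c (n (n (n (xs ! 0)))), c (n (n (n (n (xs ! 0)))))] \<and>
    (c (xs ! 0) = 1 \<and> D (xs ! 0) \<or> c (xs ! 0) = 0 \<and> \<not> D (xs ! 0)))"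
    unfolding list_encode.simps by (rule pr_intros | simp)+
  ultimately show ?thesis by (simp only: prP_def)
qed

lemma pr_equations_atomic_diagram: "pr_equations {char_fun (atomic_diagram B)} B"
proof -
  let ?\<chi> = "char_fun (atomic_diagram B)"
  have chi: "pr {?\<chi>} 1 (\<lambda>xs. ?\<chi> (xs ! 0))"
    by (intro primrec_in_pr primrec_in.basic) simp
  have "prP {?\<chi>} 4 (\<lambda>xs. ?\<chi> ([list_encode [1, xs ! 0, xs ! 1, xs ! 2, xs ! 3]] ! 0) = 1)"
    unfolding list_encode.simps by (rule pr_intros pr_comp[OF chi] | simp)+
  moreover have "?\<chi> (list_encode [1, i, a, j, b]) = 1 \<longleftrightarrow> (B ^^ i) a = (B ^^ j) b" for i a j b
    by (auto simp: char_fun_def atomic_diagram_def prod_encode_eq)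
  ultimately show ?thesis unfolding pr_equations_def by simp
qed

text \<open>The graph of the inverse is the graph with its two arguments exchanged, which keeps the
  level.\<close>

lemma Delta0_fun_in_inv:
  assumes "Delta0_fun_in X n f" and "bij f"
  shows "Delta0_fun_in X n (inv f)"
proof -
  have eq: "inv f x = y \<longleftrightarrow> f y = x" for x y
    using assms(2) by (metis bij_inv_eq_iff)
  have "Sigma0_in X n 2 (\<lambda>xs. P (xs ! 1) (xs ! 0))" if "Sigma0_in X n 2 (\<lambda>xs. P (xs ! 0) (xs ! 1))"
    for P
  proof -
    have "i < 2" if "i \<in> set [1, 0 :: nat]" for i using that by auto
    from Sigma0_in_reindex[OF that, of "[1, 0]", OF _ this] show ?thesis by simp
  qed
  from this[of "\<lambda>x y. f x = y"] this[of "\<lambda>x y. f x \<noteq> y"]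
  show ?thesis
    using assms(1) by (simp add: Delta0_fun_in_def Delta0_in_def Pi0_in_def eq)
qed

lemma Delta0_fun_in_atomic_diagram:
  assumes "Delta0_fun_in {char_fun (atomic_diagram B)} n f" and "punctual B"
  shows "Delta0_fun_in {} n f"
proof -
  obtain F where F: "primrec_in {} 1 F" "\<And>x. F [x] = char_fun (atomic_diagram B) x"
    using pr_char_fun_atomic_diagram[OF assms(2)] by (auto simp: pr_def length_Suc_conv)
  have "recursive_in {} (length [\<lambda>xs. xs ! 0]) F"
    using primrec_in_recursive_in[OF F(1)] by simp
  from recursive_in.comp[OF this, of 1]
  have "recursive_in {} 1 (\<lambda>xs. F [xs ! 0])" by (simp add: recursive_in.proj)
  then have "recursive_in {} 1 (\<lambda>xs. char_fun (atomic_diagram B) (xs ! 0))" by (simp add: F(2))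
  then have "Sigma0_in {} n 2 P" if "Sigma0_in {char_fun (atomic_diagram B)} n 2 P" for P
    using that by (intro Sigma0_in_oracle[OF that]) auto
  then show ?thesis
    using assms(1) by (simp add: Delta0_fun_in_def Delta0_in_def Pi0_in_def)
qed

lemma Cone_Delta0_subset_PRCatSpec:
  assumes "relatively_Delta0_categorical n A"
  shows "Cone_Delta0 n \<subseteq> PRCatSpec A"
proof
  fix d
  assume d: "d \<in> Cone_Delta0 n"
  have "\<exists>h. isomorphism A B h \<and> below_degree h d \<and> below_degree (inv h) d"
    if B: "punctual B" "isomorphic B A" for B
  proof -
    obtain h where h: "isomorphism A B h" "Delta0_fun_in {char_fun (atomic_diagram B)} n h"
      using assms B(2) unfolding relatively_Delta0_categorical_def by blast
    have "Delta0_fun_in {} n h" by (rule Delta0_fun_in_atomic_diagram[OF h(2) B(1)])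
    moreover from this have "Delta0_fun_in {} n (inv h)"
      using h(1) by (intro Delta0_fun_in_inv) (simp_all add: isomorphism_def)
    ultimately show ?thesis using d h(1) by (auto simp: Cone_Delta0_def)
  qed
  with d show "d \<in> PRCatSpec A" by (auto simp: PRCatSpec_def Cone_Delta0_def)
qed



section \<open>Orbits of injection structures\<close>

text \<open>Two elements of one orbit have a common forward image, so equations between iterates
  suffice and no inverse map is needed.\<close>

definition same_orbit :: "(nat \<Rightarrow> nat) \<Rightarrow> nat \<Rightarrow> nat \<Rightarrow> bool" where
  "same_orbit C x y \<longleftrightarrow> (\<exists>n m. (C ^^ n) x = (C ^^ m) y)"

definition periodic :: "(nat \<Rightarrow> nat) \<Rightarrow> nat \<Rightarrow> bool" where
  "periodic C x \<longleftrightarrow> (\<exists>n. (C ^^ Suc n) x = x)"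

definition rooted :: "(nat \<Rightarrow> nat) \<Rightarrow> nat \<Rightarrow> bool" where
  "rooted C x \<longleftrightarrow> (\<exists>r n. r \<notin> range C \<and> (C ^^ n) r = x)"

text \<open>Type \<open>0\<close> stands for \<open>\<omega>\<close>, type \<open>1\<close> for \<open>\<int>\<close> and type \<open>p + 2\<close> for a cycle of length \<open>p + 1\<close>.\<close>

definition orbit_type :: "(nat \<Rightarrow> nat) \<Rightarrow> nat \<Rightarrow> nat" where
  "orbit_type C x = (if periodic C x then Suc (Suc (LEAST n. (C ^^ Suc n) x = x))
     else if rooted C x then 0 else 1)"

text \<open>For type \<open>\<omega>\<close> the root is taken, so that every element lies ahead of
  the representative and has a counterpart in any other orbit of this type. In the other types one
  can always move backwards, and the least element will do.\<close>

definition orbit_rep :: "(nat \<Rightarrow> nat) \<Rightarrow> nat \<Rightarrow> nat" where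
  "orbit_rep C x = (LEAST y. same_orbit C x y \<and> (orbit_type C x = 0 \<longrightarrow> y \<notin> range C))"

definition orbit_reps :: "(nat \<Rightarrow> nat) \<Rightarrow> nat \<Rightarrow> nat set" where
  "orbit_reps C t = {r. orbit_rep C r = r \<and> orbit_type C r = t}"

definition orbit_rank :: "(nat \<Rightarrow> nat) \<Rightarrow> nat \<Rightarrow> nat" where
  "orbit_rank C x = card {r. r < orbit_rep C x \<and> orbit_rep C r = r \<and> orbit_type C r = orbit_type C x}"

text \<open>The offset is \<open>n - m\<close>, which may be negative; two exponents avoid integers
  and inverse iterates.\<close>

definition same_offset :: "(nat \<Rightarrow> nat) \<Rightarrow> (nat \<Rightarrow> nat) \<Rightarrow> nat \<Rightarrow> nat \<Rightarrow> nat \<Rightarrow> nat \<Rightarrow> bool" where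
  "same_offset A B r x s y \<longleftrightarrow> (\<exists>n m. (A ^^ n) r = (A ^^ m) x \<and> (B ^^ n) s = (B ^^ m) y)"

definition orbit_match :: "(nat \<Rightarrow> nat) \<Rightarrow> (nat \<Rightarrow> nat) \<Rightarrow> nat \<Rightarrow> nat \<Rightarrow> bool" where
  "orbit_match A B x y \<longleftrightarrow> orbit_type A x = orbit_type B y \<and> orbit_rank A x = orbit_rank B y \<and>
     same_offset A B (orbit_rep A x) x (orbit_rep B y) y"

lemma same_orbit_refl: "same_orbit C x x"
  unfolding same_orbit_def by blast

lemma same_orbit_sym: "same_orbit C x y \<Longrightarrow> same_orbit C y x"
  unfolding same_orbit_def by metis

lemma funpow_left_commute: "(f ^^ i) ((f ^^ j) x) = (f ^^ j) ((f ^^ i) x)"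
  using funpow_add[of i j f] funpow_add[of j i f] by (simp add: add.commute fun_eq_iff)

lemma same_orbit_trans:
  assumes "same_orbit C x y" "same_orbit C y z" shows "same_orbit C x z"
proof -
  obtain n m p q where "(C ^^ n) x = (C ^^ m) y" "(C ^^ p) y = (C ^^ q) z"
    using assms unfolding same_orbit_def by blast
  then have "(C ^^ (p + n)) x = (C ^^ (m + q)) z"
    using funpow_left_commute[of p C m y] by (simp add: funpow_add)
  then show ?thesis unfolding same_orbit_def by blast
qed

lemma same_orbit_funpow: "same_orbit C x ((C ^^ n) x)"
  unfolding same_orbit_def by (rule exI[of _ n], rule exI[of _ 0]) simp

lemma orbit_type_step:
  assumes "inj C" shows "orbit_type C (C x) = orbit_type C x"
proof -
  have 1: "(C ^^ Suc n) (C x) = C x \<longleftrightarrow> (C ^^ Suc n) x = x" for n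
    using assms by (metis comp_apply funpow_swap1 inj_eq)
  have 2: "rooted C (C x) \<longleftrightarrow> rooted C x"
  proof
    assume "rooted C (C x)"
    then obtain r n where r: "r \<notin> range C" "(C ^^ n) r = C x" by (auto simp: rooted_def)
    then obtain m where "n = Suc m" by (cases n) auto
    then have "(C ^^ m) r = x" using r(2) assms by (auto dest: injD)
    with r(1) show "rooted C x" by (auto simp: rooted_def)
  next
    assume "rooted C x"
    then obtain r n where "r \<notin> range C" "(C ^^ n) r = x" by (auto simp: rooted_def)
    then have "(C ^^ Suc n) r = C x" by simp
    with \<open>r \<notin> range C\<close> show "rooted C (C x)" unfolding rooted_def by blast
  qed
  show ?thesis unfolding orbit_type_def periodic_def 1 2 ..
qed

lemma orbit_type_funpow: "inj C \<Longrightarrow> orbit_type C ((C ^^ n) x) = orbit_type C x"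
  by (induction n) (simp_all add: orbit_type_step)

lemma same_orbit_orbit_type: "inj C \<Longrightarrow> same_orbit C x y \<Longrightarrow> orbit_type C x = orbit_type C y"
  unfolding same_orbit_def by (metis orbit_type_funpow)

lemma orbit_rep:
  shows "same_orbit C x (orbit_rep C x)" "orbit_type C x = 0 \<Longrightarrow> orbit_rep C x \<notin> range C"
proof -
  have "\<exists>y. same_orbit C x y \<and> (orbit_type C x = 0 \<longrightarrow> y \<notin> range C)"
  proof (cases "orbit_type C x = 0")
    case True
    then have "rooted C x" by (auto simp: orbit_type_def split: if_splits)
    then obtain r n where r: "r \<notin> range C" "(C ^^ n) r = x" by (auto simp: rooted_def)
    then have "same_orbit C x r" using same_orbit_funpow[of C r n] same_orbit_sym by simp
    with r(1) show ?thesis by blast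
  qed (auto intro: same_orbit_refl)
  from LeastI_ex[of "\<lambda>y. same_orbit C x y \<and> (orbit_type C x = 0 \<longrightarrow> y \<notin> range C)", OF this]
  show "same_orbit C x (orbit_rep C x)" "orbit_type C x = 0 \<Longrightarrow> orbit_rep C x \<notin> range C"
    unfolding orbit_rep_def by blast+
qed

lemma orbit_rep_eq_iff:
  assumes "inj C" shows "orbit_rep C x = orbit_rep C y \<longleftrightarrow> same_orbit C x y"
proof
  assume "orbit_rep C x = orbit_rep C y"
  then show "same_orbit C x y"
    using orbit_rep(1) same_orbit_sym same_orbit_trans by metis
next
  assume xy: "same_orbit C x y"
  then have "same_orbit C x z \<longleftrightarrow> same_orbit C y z" for z
    using same_orbit_sym same_orbit_trans by metis
  then show "orbit_rep C x = orbit_rep C y"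
    by (simp add: orbit_rep_def same_orbit_orbit_type[OF assms xy])
qed

lemma orbit_rep_in_orbit_reps:
  assumes "inj C" shows "orbit_rep C x \<in> orbit_reps C (orbit_type C x)"
proof -
  have "same_orbit C x (orbit_rep C x)" by (rule orbit_rep)
  then show ?thesis
    using orbit_rep_eq_iff[OF assms] same_orbit_orbit_type[OF assms] same_orbit_sym
    unfolding orbit_reps_def by fastforce
qed

text \<open>If there are finitely many orbits of type \<open>t\<close>, this turns having type
  \<open>t\<close> into a finite disjunction of \<open>\<Sigma>\<^sup>0\<^sub>1\<close>
  conditions.\<close>

lemma orbit_type_eq_iff:
  assumes "inj C"
  shows "orbit_type C x = t \<longleftrightarrow> (\<exists>r\<in>orbit_reps C t. same_orbit C r x)"
proof
  assume "orbit_type C x = t"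
  then show "\<exists>r\<in>orbit_reps C t. same_orbit C r x"
    using orbit_rep_in_orbit_reps[OF assms] orbit_rep(1) same_orbit_sym by metis
qed (auto simp: orbit_reps_def dest: same_orbit_orbit_type[OF assms])

lemma funpow_eq_self_iff:
  assumes "periodic C x"
  shows "(C ^^ d) x = x \<longleftrightarrow> Suc (LEAST n. (C ^^ Suc n) x = x) dvd d"
proof -
  define l where "l = (LEAST n. (C ^^ Suc n) x = x)"
  define p where "p = Suc l"
  have p: "(C ^^ p) x = x"
    using assms LeastI_ex[of "\<lambda>n. (C ^^ Suc n) x = x"] unfolding periodic_def p_def l_def by blast
  have 1: "(C ^^ d) x = (C ^^ (d mod p)) x" using funpow_mod_eq[OF p] by simp
  have 2: "(C ^^ (d mod p)) x = x \<longleftrightarrow> d mod p = 0"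
  proof (cases "d mod p")
    case (Suc m)
    have "d mod p < p" unfolding p_def by simp
    then have "m < l" using Suc unfolding p_def by simp
    from not_less_Least[OF this[unfolded l_def]] show ?thesis using Suc by simp
  qed simp
  show ?thesis
    unfolding p_def[unfolded l_def, symmetric] dvd_eq_mod_eq_0 1 by (rule 2)
qed

lemma orbit_type_funpow_eq_self:
  assumes "orbit_type A x = orbit_type B y" shows "(A ^^ d) x = x \<longleftrightarrow> (B ^^ d) y = y"
proof (cases "periodic A x")
  case True
  then have "periodic B y"
    and "(LEAST n. (A ^^ Suc n) x = x) = (LEAST n. (B ^^ Suc n) y = y)"
    using assms by (auto simp: orbit_type_def split: if_splits)
  with True show ?thesis by (simp add: funpow_eq_self_iff)
next
  case False
  moreover from this have "\<not> periodic B y"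
    using assms by (auto simp: orbit_type_def split: if_splits)
  ultimately show ?thesis unfolding periodic_def by (cases d) auto
qed

text \<open>By injectivity a coincidence of two iterates is a return after the difference of the
  exponents, and the type determines the return times.\<close>

lemma orbit_type_funpow_eq:
  assumes "inj A" "inj B" "orbit_type A x = orbit_type B y"
  shows "(A ^^ i) x = (A ^^ j) x \<longleftrightarrow> (B ^^ i) y = (B ^^ j) y"
proof -
  have *: "(C ^^ i) x = (C ^^ (i + d)) x \<longleftrightarrow> (C ^^ d) x = x" if "inj C" for C :: "nat \<Rightarrow> nat" and i d x
    using inj_eq[OF inj_fn[OF that, of i], of "x" "(C ^^ d) x"] by (auto simp: funpow_add)
  show ?thesis
  proof (cases "i \<le> j")
    case True
    then obtain d where "j = i + d" using le_Suc_ex by blast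
    then show ?thesis using * assms orbit_type_funpow_eq_self by metis
  next
    case False
    then obtain d where "i = j + d" using le_Suc_ex nat_le_linear by blast
    then show ?thesis using * assms orbit_type_funpow_eq_self by metis
  qed
qed

lemma orbit_type_pos_range:
  assumes "orbit_type C x \<noteq> 0" shows "x \<in> range C"
proof (cases "periodic C x")
  case True
  then show ?thesis by (auto simp: periodic_def intro: range_eqI[OF sym])
next
  case False
  with assms have "\<not> rooted C x" by (auto simp: orbit_type_def split: if_splits)
  then have "\<not> (x \<notin> range C \<and> (C ^^ 0) x = x)" unfolding rooted_def by blast
  then show ?thesis by simp
qed

lemma orbit_type_pos_funpow_range:
  assumes "inj C" "orbit_type C x \<noteq> 0" shows "\<exists>y. (C ^^ d) y = x"
proof (induction d)
  case (Suc d)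
  then obtain y where y: "(C ^^ d) y = x" ..
  then have "orbit_type C y \<noteq> 0" using assms orbit_type_funpow by metis
  then obtain z where "y = C z" using orbit_type_pos_range by blast
  with y have "(C ^^ Suc d) z = x" by (simp add: funpow_swap1)
  then show ?case ..
qed simp

lemma same_offset_ex:
  assumes "inj A" "inj B" and t: "orbit_type A x = orbit_type B s" and s: "same_orbit A x r"
    and r: "orbit_type A x = 0 \<Longrightarrow> r \<notin> range A"
  shows "\<exists>y. same_offset A B r x s y"
proof -
  obtain n m where nm: "(A ^^ n) r = (A ^^ m) x" using s unfolding same_orbit_def by metis
  have "\<exists>y. (B ^^ n) s = (B ^^ m) y"
  proof (cases "m \<le> n")
    case True
    then obtain d where d: "n = m + d" using le_Suc_ex by blast
    have "(B ^^ n) s = (B ^^ m) ((B ^^ d) s)" by (simp add: d funpow_add)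
    then show ?thesis ..
  next
    case False
    then obtain d where d: "m = n + Suc d"
      using less_imp_Suc_add[of n m] by auto
    \<comment> \<open>Here \<open>x\<close> lies strictly before \<open>r\<close>, so
      \<open>r\<close> is no root, the type is not \<open>\<omega>\<close>, and one can go back from
      \<open>s\<close> as well.\<close>
    have "(A ^^ n) r = (A ^^ n) ((A ^^ Suc d) x)" using nm by (simp only: d funpow_add comp_apply)
    then have "r = (A ^^ Suc d) x" by (rule injD[OF inj_fn[OF assms(1)]])
    then have "orbit_type A x \<noteq> 0" using r by auto
    then obtain y where y: "(B ^^ Suc d) y = s"
      using orbit_type_pos_funpow_range[OF assms(2)] t by metis
    have "(B ^^ n) s = (B ^^ m) y" unfolding d funpow_add comp_apply y ..
    then show ?thesis ..
  qed
  with nm show ?thesis unfolding same_offset_def by blast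
qed

text \<open>Eliminating \<open>x\<close> from the two offsets gives a coincidence of iterates of
  \<open>r\<close>; it transfers to \<open>s\<close>, since coincidences depend only on the
  type.\<close>

lemma same_offset_unique:
  assumes "inj A" "inj B" and t: "orbit_type A r = orbit_type B s"
    and "same_offset A B r x s y" "same_offset A B r x s z"
  shows "y = z"
proof -
  obtain n m where 1: "(A ^^ n) r = (A ^^ m) x" "(B ^^ n) s = (B ^^ m) y"
    using assms(4) unfolding same_offset_def by blast
  obtain p q where 2: "(A ^^ p) r = (A ^^ q) x" "(B ^^ p) s = (B ^^ q) z"
    using assms(5) unfolding same_offset_def by blast
  have "(A ^^ (q + n)) r = (A ^^ (m + p)) r"
    using funpow_left_commute[of q A m x] by (simp only: 1 2 funpow_add comp_apply)
  then have "(B ^^ (q + n)) s = (B ^^ (m + p)) s"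
    using orbit_type_funpow_eq[OF assms(1-3)] by blast
  then have "(B ^^ m) ((B ^^ q) y) = (B ^^ m) ((B ^^ q) z)"
    using funpow_left_commute[of q B m y] by (simp only: 1 2 funpow_add comp_apply)
  then show ?thesis using inj_fn[OF assms(2)] by (simp only: inj_eq)
qed

section \<open>Ranks and the matching of orbits\<close>

lemma ex_rank:
  fixes T :: "nat set"
  assumes "T \<noteq> {}" and "finite T \<Longrightarrow> n < card T"
  shows "\<exists>y\<in>T. card {z. z < y \<and> z \<in> T} = n"
  using assms
proof (induction n arbitrary: T)
  case 0
  define l where "l = (LEAST y. y \<in> T)"
  have "l \<in> T" unfolding l_def using 0 LeastI_ex[of "\<lambda>y. y \<in> T"] by blast
  moreover have "y \<notin> T" if "y < l" for y using not_less_Least that unfolding l_def by blast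
  ultimately show ?case by (intro bexI[of _ l]) auto
next
  case (Suc n)
  define l where "l = (LEAST y. y \<in> T)"
  have l: "l \<in> T" unfolding l_def using Suc.prems LeastI_ex[of "\<lambda>y. y \<in> T"] by blast
  have l': "l \<le> y" if "y \<in> T" for y unfolding l_def using that by (rule Least_le)
  have fin: "n < card (T - {l})" if "finite (T - {l})"
    using that Suc.prems l by auto
  have "T - {l} \<noteq> {}"
    using fin by (metis card.empty finite.emptyI not_less_zero)
  from Suc.IH[OF this fin] obtain y
    where y: "y \<in> T - {l}" "card {z. z < y \<and> z \<in> T - {l}} = n" by blast
  have "{z. z < y \<and> z \<in> T} = insert l {z. z < y \<and> z \<in> T - {l}}"
    using l l'[of y] y(1) by (auto simp: le_less)
  then have "card {z. z < y \<and> z \<in> T} = Suc n"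
    using y(2) by simp
  with y show ?case by blast
qed

lemma rank_unique:
  fixes T :: "nat set"
  assumes "x \<in> T" "y \<in> T" "card {z. z < x \<and> z \<in> T} = card {z. z < y \<and> z \<in> T}"
  shows "x = y"
proof -
  have "card {z. z < a \<and> z \<in> T} < card {z. z < b \<and> z \<in> T}" if "a < b" "a \<in> T" for a b
    using that by (intro psubset_card_mono) auto
  from this[of x y] this[of y x] show ?thesis
    using assms by (cases x y rule: linorder_cases) auto
qed

text \<open>The injection matters only through cardinalities: it guarantees that \<open>T\<close> is
  large enough to have an element of the given rank.\<close>

lemma rank_transfer:
  fixes S T :: "nat set"
  assumes "inj_on f S" "f ` S \<subseteq> T" "x \<in> S"
  shows "\<exists>y\<in>T. card {z. z < y \<and> z \<in> T} = card {z. z < x \<and> z \<in> S}"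
proof (rule ex_rank)
  show "T \<noteq> {}" using assms by auto
  assume "finite T"
  then have "finite S" "card S \<le> card T"
    using assms by (auto intro: inj_on_finite card_inj_on_le)
  moreover have "card {z. z < x \<and> z \<in> S} < card S"
    using \<open>finite S\<close> assms(3) by (intro psubset_card_mono) auto
  ultimately show "card {z. z < x \<and> z \<in> S} < card T" by simp
qed

text \<open>Compares the numbers of orbits of type \<open>t\<close>. Embeddings in both directions
  replace a bijection, because orbits are paired by rank and not by the embedding.\<close>

definition orbits_embed :: "(nat \<Rightarrow> nat) \<Rightarrow> (nat \<Rightarrow> nat) \<Rightarrow> nat \<Rightarrow> bool" where
  "orbits_embed A B t \<longleftrightarrow> (\<exists>f. inj_on f (orbit_reps A t) \<and> f ` orbit_reps A t \<subseteq> orbit_reps B t)"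

lemma orbits_embedI:
  assumes "inj A" "inj B" and "\<And>x. orbit_type A x = t \<Longrightarrow> orbit_type B (e x) = t"
    and "\<And>x y. \<lbrakk>orbit_type A x = t; orbit_type A y = t; same_orbit B (e x) (e y)\<rbrakk> \<Longrightarrow> same_orbit A x y"
  shows "orbits_embed A B t"
  unfolding orbits_embed_def
proof (intro exI conjI)
  show "inj_on (\<lambda>x. orbit_rep B (e x)) (orbit_reps A t)"
  proof (rule inj_onI)
    fix x y
    assume xy: "x \<in> orbit_reps A t" "y \<in> orbit_reps A t" "orbit_rep B (e x) = orbit_rep B (e y)"
    then have "same_orbit A x y"
      using assms(4) orbit_rep_eq_iff[OF assms(2)] by (simp add: orbit_reps_def)
    then have "orbit_rep A x = orbit_rep A y" by (simp only: orbit_rep_eq_iff[OF assms(1)])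
    then show "x = y" using xy(1,2) by (simp add: orbit_reps_def)
  qed
  show "(\<lambda>x. orbit_rep B (e x)) ` orbit_reps A t \<subseteq> orbit_reps B t"
    using assms(3) orbit_rep_in_orbit_reps[OF assms(2)] by (auto simp: orbit_reps_def)
qed

lemma orbits_embed_infinite:
  assumes "infinite (orbit_reps B t)" shows "orbits_embed A B t"
  unfolding orbits_embed_def
proof (intro exI conjI)
  have "inj (enumerate (orbit_reps B t))"
    using strict_mono_enumerate[OF assms] by (rule strict_mono_imp_inj_on)
  then show "inj_on (enumerate (orbit_reps B t)) (orbit_reps A t)" by (rule inj_on_subset) simp
  show "enumerate (orbit_reps B t) ` orbit_reps A t \<subseteq> orbit_reps B t"
    using enumerate_in_set[OF assms] by auto
qed

lemma orbit_rank_eq: "orbit_rank C x = card {r. r < orbit_rep C x \<and> r \<in> orbit_reps C (orbit_type C x)}"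
  by (simp add: orbit_rank_def orbit_reps_def)

lemma orbit_match_ex:
  assumes "inj A" "inj B" and "orbits_embed A B (orbit_type A x)"
  shows "\<exists>y. orbit_match A B x y"
proof -
  define t where "t = orbit_type A x"
  obtain f where f: "inj_on f (orbit_reps A t)" "f ` orbit_reps A t \<subseteq> orbit_reps B t"
    using assms(3) unfolding orbits_embed_def t_def by blast
  have "orbit_rep A x \<in> orbit_reps A t"
    using orbit_rep_in_orbit_reps[OF assms(1)] by (simp add: t_def)
  from rank_transfer[OF f this]
  obtain s where s: "s \<in> orbit_reps B t" "orbit_rank A x = card {z. z < s \<and> z \<in> orbit_reps B t}"
    unfolding orbit_rank_eq t_def by metis
  have ts: "orbit_type A x = orbit_type B s" "orbit_rep B s = s"
    using s(1) by (auto simp: orbit_reps_def t_def)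
  obtain y where y: "same_offset A B (orbit_rep A x) x s y"
    using same_offset_ex[OF assms(1,2) ts(1) orbit_rep] by blast
  then have "same_orbit B s y" unfolding same_offset_def same_orbit_def by blast
  then have "orbit_rep B y = s" "orbit_type B y = t"
    using orbit_rep_eq_iff[OF assms(2)] same_orbit_orbit_type[OF assms(2)] ts by (metis, metis t_def)
  then have "orbit_match A B x y"
    using y s(2) by (simp add: orbit_match_def t_def orbit_rank_eq)
  then show ?thesis ..
qed

lemma orbit_match_sym: "orbit_match A B x y \<Longrightarrow> orbit_match B A y x"
  unfolding orbit_match_def same_offset_def by metis

lemma orbit_match_unique:
  assumes "inj A" "inj B" "orbit_match A B x y" "orbit_match A B x z" shows "y = z"
proof -
  have t: "orbit_type B y = orbit_type A x" "orbit_type B z = orbit_type A x"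
    using assms(3,4) by (simp_all add: orbit_match_def)
  have "orbit_rep B y = orbit_rep B z"
  proof (rule rank_unique)
    show "orbit_rep B y \<in> orbit_reps B (orbit_type A x)" "orbit_rep B z \<in> orbit_reps B (orbit_type A x)"
      using orbit_rep_in_orbit_reps[OF assms(2)] t by metis+
    show "card {r. r < orbit_rep B y \<and> r \<in> orbit_reps B (orbit_type A x)}
        = card {r. r < orbit_rep B z \<and> r \<in> orbit_reps B (orbit_type A x)}"
      using assms(3,4) t by (simp add: orbit_match_def orbit_rank_eq)
  qed
  moreover have "orbit_type A (orbit_rep A x) = orbit_type B (orbit_rep B y)"
    using orbit_rep_in_orbit_reps[OF assms(1), of x] orbit_rep_in_orbit_reps[OF assms(2), of y] t
    by (simp add: orbit_reps_def)
  ultimately show ?thesis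
    using assms(3,4) same_offset_unique[OF assms(1,2), of "orbit_rep A x" "orbit_rep B y" x y z]
    by (simp add: orbit_match_def)
qed

lemma orbit_match_step:
  assumes "inj A" "inj B" "orbit_match A B x y" shows "orbit_match A B (A x) (B y)"
proof -
  have r: "orbit_rep C (C z) = orbit_rep C z" if "inj C" for C z
    using orbit_rep_eq_iff[OF that] same_orbit_funpow[of C z 1] same_orbit_sym by fastforce
  obtain n m where "(A ^^ n) (orbit_rep A x) = (A ^^ m) x" "(B ^^ n) (orbit_rep B y) = (B ^^ m) y"
    using assms(3) unfolding orbit_match_def same_offset_def by blast
  then have "(A ^^ Suc n) (orbit_rep A x) = (A ^^ m) (A x)"
    "(B ^^ Suc n) (orbit_rep B y) = (B ^^ m) (B y)" by (simp_all add: funpow_swap1)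
  then show ?thesis
    using assms(3) unfolding orbit_match_def same_offset_def orbit_rank_def
      orbit_type_step[OF assms(1)] orbit_type_step[OF assms(2)] r[OF assms(1)] r[OF assms(2)]
    by blast
qed

text \<open>The matching relation is total and single-valued in both directions.
  \<open>LEAST\<close> rather than a choice operator makes the isomorphism accessible to
  \<open>limit_pr_Least\<close>.\<close>

lemma isomorphism_orbit_match:
  assumes "inj A" "inj B" and AB: "\<And>t. orbits_embed A B t" and BA: "\<And>t. orbits_embed B A t"
  shows "isomorphism A B (\<lambda>x. LEAST y. orbit_match A B x y)" (is "isomorphism A B ?h")
proof -
  have h: "orbit_match A B x (?h x)" for x
    using LeastI_ex[OF orbit_match_ex[OF assms(1,2) AB]] .
  have eq: "orbit_match A B x y \<Longrightarrow> ?h x = y" for x y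
    using h orbit_match_unique[OF assms(1,2)] by blast
  have "inj ?h"
    using h orbit_match_unique[OF assms(2,1)] orbit_match_sym by (intro injI) metis
  moreover have "surj ?h"
    using orbit_match_ex[OF assms(2,1) BA] orbit_match_sym eq by (intro surjI[where f = "\<lambda>y. SOME x. orbit_match A B x y"]) (metis someI_ex)
  ultimately show ?thesis
    unfolding isomorphism_def bij_def using eq orbit_match_step[OF assms(1,2) h] by blast
qed

section \<open>Invariance of orbits and types under isomorphisms\<close>

lemma isomorphism_funpow: "isomorphism A B g \<Longrightarrow> g ((A ^^ n) x) = (B ^^ n) (g x)"
  by (induction n) (auto simp: isomorphism_def)

lemma isomorphism_same_orbit:
  assumes "isomorphism A B g" shows "same_orbit B (g x) (g y) \<longleftrightarrow> same_orbit A x y"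
  using assms unfolding same_orbit_def isomorphism_funpow[OF assms, symmetric]
  by (auto simp: isomorphism_def bij_def inj_eq)

lemma isomorphism_inv:
  assumes "isomorphism A B g" shows "isomorphism B A (inv g)"
  using assms unfolding isomorphism_def
  by (metis bij_betw_imp_inj_on bij_imp_bij_inv bij_inv_eq_iff inv_f_f)

lemma isomorphism_orbit_type:
  assumes g: "isomorphism A B g" shows "orbit_type B (g x) = orbit_type A x"
proof -
  have bij: "bij g" using g by (simp add: isomorphism_def)
  have 1: "(B ^^ n) (g x) = g x \<longleftrightarrow> (A ^^ n) x = x" for n
    using bij unfolding isomorphism_funpow[OF g, symmetric] by (simp add: bij_def inj_eq)
  have "rooted B (g x)" if iso: "isomorphism A B g" and root: "rooted A x" for A B g x
  proof -
    obtain r n where r: "r \<notin> range A" "(A ^^ n) r = x" using root by (auto simp: rooted_def)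
    have "g r \<notin> range B"
    proof
      assume "g r \<in> range B"
      then obtain y where "g r = B y" by blast
      moreover obtain z where "y = g z" using iso by (metis isomorphism_def bij_pointE)
      ultimately have "g r = g (A z)" using iso by (simp add: isomorphism_def)
      moreover have "inj g" using iso by (simp add: isomorphism_def bij_def)
      ultimately have "r = A z" by (rule injD[rotated])
      with r(1) show False by blast
    qed
    moreover have "(B ^^ n) (g r) = g x" using isomorphism_funpow[OF iso] r(2) by metis
    ultimately show ?thesis unfolding rooted_def by blast
  qed
  from this[OF g] this[OF isomorphism_inv[OF g], of "g x"]
  have 2: "rooted B (g x) \<longleftrightarrow> rooted A x"
    using bij by (auto simp: bij_def)
  show ?thesis unfolding orbit_type_def periodic_def 1 2 ..
qed

lemma isomorphism_inj:
  assumes g: "isomorphism A B g" and "inj A" shows "inj B"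
proof (rule injI)
  fix x y
  assume "B x = B y"
  moreover obtain x' y' where "x = g x'" "y = g y'" using g by (metis isomorphism_def bij_pointE)
  ultimately have "g (A x') = g (A y')" using g by (simp add: isomorphism_def)
  moreover have "inj g" using g by (simp add: isomorphism_def bij_def)
  ultimately have "A x' = A y'" by (rule injD[rotated])
  then show "x = y" using \<open>inj A\<close> \<open>x = g x'\<close> \<open>y = g y'\<close> by (simp add: inj_eq)
qed

lemma isomorphism_orbits_embed:
  assumes "isomorphism A B g" "inj A" shows "orbits_embed A B t"
  using isomorphism_orbit_type[OF assms(1)] isomorphism_same_orbit[OF assms(1)]
    isomorphism_inj[OF assms] assms(2)
  by (intro orbits_embedI[where e = g]) auto



section \<open>Relative \<open>\<Delta>\<^sup>0\<^sub>2\<close>-categoricity\<close>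

lemma prP_equations:
  assumes "pr_equations X C" "pr X k i" "pr X k a" "pr X k j" "pr X k b"
  shows "prP X k (\<lambda>xs. (C ^^ i xs) (a xs) = (C ^^ j xs) (b xs))"
  using prP_comp[OF assms(1)[unfolded pr_equations_def]
      prl_Cons[OF assms(2) prl_Cons[OF assms(3) prl_Cons[OF assms(4) prl_Cons[OF assms(5) prl_Nil]]]]]
  by simp

lemma limit_pr_comp1:
  assumes "limit_pr X 1 (\<lambda>xs. f (xs ! 0))" "limit_pr X k a"
  shows "limit_pr X k (\<lambda>xs. f (a xs))"
  using limit_pr_comp[OF assms(1) limit_prl_Cons[OF assms(2) limit_prl_Nil]] by simp

lemma limit_prP_comp1:
  assumes "limit_prP X 1 (\<lambda>xs. P (xs ! 0))" "limit_pr X k a"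
  shows "limit_prP X k (\<lambda>xs. P (a xs))"
  using limit_prP_comp[OF assms(1) limit_prl_Cons[OF assms(2) limit_prl_Nil]] by simp

lemma limit_prP_comp2:
  assumes "limit_prP X 2 (\<lambda>xs. P (xs ! 0) (xs ! 1))" "limit_pr X k a" "limit_pr X k b"
  shows "limit_prP X k (\<lambda>xs. P (a xs) (b xs))"
  using limit_prP_comp[OF assms(1) limit_prl_Cons[OF assms(2) limit_prl_Cons[OF assms(3) limit_prl_Nil]]]
  by simp

lemma limit_prP_ex_pair:
  assumes "prP X (Suc k) (\<lambda>ys. P (fst (prod_decode (hd ys))) (snd (prod_decode (hd ys))) (tl ys))"
  shows "limit_prP X k (\<lambda>xs. \<exists>n m. P n m xs)"
proof (rule limit_prP_cong)
  show "limit_prP X k (\<lambda>xs. \<exists>w. P (fst (prod_decode w)) (snd (prod_decode w)) xs)"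
    by (rule limit_prP_ex[OF assms])
  show "(\<exists>n m. P n m xs) = (\<exists>w. P (fst (prod_decode w)) (snd (prod_decode w)) xs)" for xs
    by (metis fst_conv prod_encode_inverse snd_conv)
qed

lemma limit_prP_same_orbit:
  assumes "pr_equations X C" shows "limit_prP X 2 (\<lambda>xs. same_orbit C (xs ! 0) (xs ! 1))"
  unfolding same_orbit_def
  by (rule limit_prP_ex_pair) (rule prP_equations[OF assms] pr_intros | simp)+

lemma limit_prP_same_offset:
  assumes "pr_equations X A" "pr_equations X B"
  shows "limit_prP X 4 (\<lambda>xs. same_offset A B (xs ! 0) (xs ! 1) (xs ! 2) (xs ! 3))"
  unfolding same_offset_def
  by (rule limit_prP_ex_pair)
    (rule prP_equations[OF assms(1)] prP_equations[OF assms(2)] pr_intros | simp)+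

lemma limit_prP_periodic:
  assumes "pr_equations X C" shows "limit_prP X 1 (\<lambda>xs. periodic C (xs ! 0))"
proof -
  have "prP X (Suc 1) (\<lambda>ys. (C ^^ Suc (hd ys)) (tl ys ! 0) = (C ^^ 0) (tl ys ! 0))"
    by (rule prP_equations[OF assms] pr_intros | simp)+
  from limit_prP_ex[OF this] show ?thesis by (simp add: periodic_def)
qed

lemma limit_prP_range:
  assumes "pr_equations X C" shows "limit_prP X 1 (\<lambda>xs. xs ! 0 \<in> range C)"
proof -
  have "prP X (Suc 1) (\<lambda>ys. (C ^^ 0) (tl ys ! 0) = (C ^^ 1) (hd ys))"
    by (rule prP_equations[OF assms] pr_intros | simp)+
  from limit_prP_ex[OF this] show ?thesis by (simp add: image_iff)
qed

lemma limit_prP_finite_same_orbit: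
  assumes "pr_equations X C" "finite S"
  shows "limit_prP X 1 (\<lambda>xs. \<exists>r\<in>S. same_orbit C r (xs ! 0))"
  using assms(2)
proof (induction S)
  case empty
  then show ?case by (simp add: prP_limit_prP prP_const)
next
  case (insert r S)
  have "limit_prP X 1 (\<lambda>xs. same_orbit C r (xs ! 0) \<or> (\<exists>r\<in>S. same_orbit C r (xs ! 0)))"
    by (intro limit_prP_disj insert.IH limit_prP_comp2[OF limit_prP_same_orbit[OF assms(1)]])
      (rule limit_intros | simp)+
  then show ?case by simp
qed

text \<open>Periodicity is \<open>\<Sigma>\<^sup>0\<^sub>1\<close>, and so is membership in one of finitely many orbits. Hence the types of
  orbits are decidable in the limit as soon as one of the two types of infinite orbits occurs
  only finitely often.\<close>

lemma limit_pr_orbit_type: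
  assumes C: "pr_equations X C" and "inj C"
    and fin: "finite (orbit_reps C 0) \<or> finite (orbit_reps C 1)"
  shows "limit_pr X 1 (\<lambda>xs. orbit_type C (xs ! 0))"
proof -
  have per: "limit_prP X 1 (\<lambda>xs. periodic C (xs ! 0))" by (rule limit_prP_periodic[OF C])
  \<comment> \<open>The guard \<open>periodic\<close> makes the search for the period succeed
    trivially for aperiodic elements, as \<open>limit_pr_Least\<close> requires a witness
    everywhere.\<close>
  have "limit_prP X (Suc 1) (\<lambda>ys. periodic C (tl ys ! 0) \<longrightarrow> (C ^^ Suc (hd ys)) (tl ys ! 0) = (C ^^ 0) (tl ys ! 0))"
    by (intro limit_prP_imp prP_limit_prP prP_equations[OF C] limit_prP_comp1[OF per])
      (rule limit_intros pr_intros | simp)+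
  from limit_pr_Least[OF this]
  have L: "limit_pr X 1 (\<lambda>xs. LEAST n. periodic C (xs ! 0) \<longrightarrow> (C ^^ Suc n) (xs ! 0) = xs ! 0)"
    by (auto simp: periodic_def)
  have "limit_prP X 1 (\<lambda>xs. orbit_type C (xs ! 0) = 0)" if "finite (orbit_reps C 0)"
    using limit_prP_finite_same_orbit[OF C that] by (simp add: orbit_type_eq_iff[OF assms(2)])
  moreover have "limit_prP X 1 (\<lambda>xs. orbit_type C (xs ! 0) = 1)" if "finite (orbit_reps C 1)"
    using limit_prP_finite_same_orbit[OF C that] by (simp add: orbit_type_eq_iff[OF assms(2)])
  \<comment> \<open>\<open>t\<close> is the infinite type that occurs finitely often; an aperiodic
    element not of type \<open>t\<close> has the other infinite type \<open>1 - t\<close>.\<close>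
  ultimately have "\<exists>t. t < 2 \<and> limit_prP X 1 (\<lambda>xs. orbit_type C (xs ! 0) = t)"
    using fin by (metis one_less_numeral_iff semiring_norm(76) zero_less_numeral)
  then obtain t where t: "t < 2" "limit_prP X 1 (\<lambda>xs. orbit_type C (xs ! 0) = t)" by blast
  have "limit_pr X 1 (\<lambda>xs. if periodic C (xs ! 0)
      then Suc (Suc (LEAST n. periodic C (xs ! 0) \<longrightarrow> (C ^^ Suc n) (xs ! 0) = xs ! 0))
      else if orbit_type C (xs ! 0) = t then t else 1 - t)"
    by (intro limit_pr_if limit_pr_Suc L per t(2) limit_pr_const)
  then show ?thesis
    by (rule limit_pr_cong) (use t(1) in \<open>auto simp: orbit_type_def\<close>)
qed

lemma limit_pr_orbit_rep:
  assumes C: "pr_equations X C" and t: "limit_pr X 1 (\<lambda>xs. orbit_type C (xs ! 0))"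
  shows "limit_pr X 1 (\<lambda>xs. orbit_rep C (xs ! 0))"
  unfolding orbit_rep_def
proof (rule limit_pr_Least)
  show "limit_prP X (Suc 1) (\<lambda>ys. same_orbit C (tl ys ! 0) (hd ys) \<and>
      (orbit_type C (tl ys ! 0) = 0 \<longrightarrow> hd ys \<notin> range C))"
    by (rule limit_intros limit_prP_comp2[OF limit_prP_same_orbit[OF C]] limit_pr_comp1[OF t]
        limit_prP_comp1[OF limit_prP_range[OF C]] | simp)+
qed (use orbit_rep in blast)

lemma limit_pr_orbit_rank:
  assumes t: "limit_pr X 1 (\<lambda>xs. orbit_type C (xs ! 0))"
    and r: "limit_pr X 1 (\<lambda>xs. orbit_rep C (xs ! 0))"
  shows "limit_pr X 1 (\<lambda>xs. orbit_rank C (xs ! 0))"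
  unfolding orbit_rank_def
  by (rule limit_pr_card limit_intros limit_pr_comp1[OF t] limit_pr_comp1[OF r] | simp)+

lemma limit_prP_orbit_match:
  assumes "pr_equations X A" "inj A" "finite (orbit_reps A 0) \<or> finite (orbit_reps A 1)"
    and "pr_equations X B" "inj B" "finite (orbit_reps B 0) \<or> finite (orbit_reps B 1)"
  shows "limit_prP X 2 (\<lambda>xs. orbit_match A B (xs ! 0) (xs ! 1))"
proof -
  note tA = limit_pr_orbit_type[OF assms(1-3)] and tB = limit_pr_orbit_type[OF assms(4-6)]
  note rA = limit_pr_orbit_rep[OF assms(1) tA] and rB = limit_pr_orbit_rep[OF assms(4) tB]
  note kA = limit_pr_orbit_rank[OF tA rA] and kB = limit_pr_orbit_rank[OF tB rB]
  have "limit_prP X 2 (\<lambda>xs. same_offset A B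
    ([orbit_rep A (xs ! 0), xs ! 0, orbit_rep B (xs ! 1), xs ! 1] ! 0)
    ([orbit_rep A (xs ! 0), xs ! 0, orbit_rep B (xs ! 1), xs ! 1] ! 1)
    ([orbit_rep A (xs ! 0), xs ! 0, orbit_rep B (xs ! 1), xs ! 1] ! 2)
    ([orbit_rep A (xs ! 0), xs ! 0, orbit_rep B (xs ! 1), xs ! 1] ! 3))"
    by (rule limit_prP_comp[OF limit_prP_same_offset[OF assms(1,4)]])
      (rule limit_intros limit_pr_comp1[OF rA] limit_pr_comp1[OF rB] | simp)+
  then have "limit_prP X 2 (\<lambda>xs. same_offset A B
      (orbit_rep A (xs ! 0)) (xs ! 0) (orbit_rep B (xs ! 1)) (xs ! 1))" by simp
  then show ?thesis
    unfolding orbit_match_def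
    by (intro limit_prP_conj limit_prP_eq limit_pr_comp1[OF tA] limit_pr_comp1[OF tB]
        limit_pr_comp1[OF kA] limit_pr_comp1[OF kB] limit_pr_nth) simp_all
qed

lemma isomorphism_finite_orbit_reps:
  assumes "isomorphism A B g" "inj A" "finite (orbit_reps A t)" shows "finite (orbit_reps B t)"
  using isomorphism_orbits_embed[OF isomorphism_inv[OF assms(1)] isomorphism_inj[OF assms(1,2)], of t] assms(3)
  unfolding orbits_embed_def by (auto intro: inj_on_finite)

lemma relatively_Delta0_2_categorical:
  assumes A: "punctual A" "inj A" and fin: "finite (orbit_reps A 0) \<or> finite (orbit_reps A 1)"
  shows "relatively_Delta0_categorical 2 A"
  unfolding relatively_Delta0_categorical_def
proof (intro allI impI)
  fix B
  assume "isomorphic B A"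
  then obtain g where "isomorphism B A g" by (auto simp: isomorphic_def)
  then have g: "isomorphism A B (inv g)" by (rule isomorphism_inv)
  note B = isomorphism_inj[OF g A(2)]
  let ?X = "{char_fun (atomic_diagram B)}"
  have finB: "finite (orbit_reps B 0) \<or> finite (orbit_reps B 1)"
    using fin isomorphism_finite_orbit_reps[OF g A(2)] by blast
  note AB = isomorphism_orbits_embed[OF g A(2)]
  have match: "limit_prP ?X 2 (\<lambda>xs. orbit_match A B (xs ! 0) (xs ! 1))"
    by (rule limit_prP_orbit_match[OF pr_equations_punctual[OF A(1)] A(2) fin
          pr_equations_atomic_diagram B finB])
  have "limit_pr ?X 1 (\<lambda>xs. LEAST y. orbit_match A B (xs ! 0) y)"
  proof (rule limit_pr_Least)
    show "limit_prP ?X (Suc 1) (\<lambda>ys. orbit_match A B (tl ys ! 0) (hd ys))"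
      by (rule limit_prP_comp2[OF match]) (rule limit_intros | simp)+
  qed (rule orbit_match_ex[OF A(2) B AB])
  then have "Delta0_fun_in ?X 2 (\<lambda>x. LEAST y. orbit_match A B x y)"
    by (rule limit_pr_Delta0_fun_in)
  moreover have "isomorphism A B (\<lambda>x. LEAST y. orbit_match A B x y)"
    by (rule isomorphism_orbit_match[OF A(2) B AB isomorphism_orbits_embed[OF isomorphism_inv[OF g] B]])
  ultimately show "\<exists>h. isomorphism A B h \<and> Delta0_fun_in ?X 2 h" by blast
qed



section \<open>Copies with prescribed \<open>\<int>\<close>-orbits\<close>

text \<open>Being a cycle of a given length involves only bounded quantifiers, hence is primitive
  recursive; this is what lets a guessed period be verified at once.\<close>

lemma orbit_type_eq_Suc_Suc_iff:
  "orbit_type C x = Suc (Suc p) \<longleftrightarrow> (C ^^ Suc p) x = x \<and> (\<forall>q<p. (C ^^ Suc q) x \<noteq> x)"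
proof
  assume "orbit_type C x = Suc (Suc p)"
  then have per: "periodic C x" and p: "p = (LEAST n. (C ^^ Suc n) x = x)"
    by (auto simp: orbit_type_def split: if_splits)
  show "(C ^^ Suc p) x = x \<and> (\<forall>q<p. (C ^^ Suc q) x \<noteq> x)"
    using LeastI_ex[of "\<lambda>n. (C ^^ Suc n) x = x"] not_less_Least[of _ "\<lambda>n. (C ^^ Suc n) x = x"] per
    unfolding p periodic_def by blast
next
  assume p: "(C ^^ Suc p) x = x \<and> (\<forall>q<p. (C ^^ Suc q) x \<noteq> x)"
  then have "periodic C x" unfolding periodic_def by blast
  moreover have "(LEAST n. (C ^^ Suc n) x = x) = p"
    by (rule Least_equality) (use p linorder_not_less in blast)+
  ultimately show "orbit_type C x = Suc (Suc p)" by (simp only: orbit_type_def if_True)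
qed

lemma orbit_type_not_range: "x \<notin> range C \<Longrightarrow> orbit_type C x = 0"
  using orbit_type_pos_range by blast

lemma infinite_orbit_reps:
  assumes "inj C" "infinite P" and t: "\<And>p. p \<in> P \<Longrightarrow> orbit_type C (w p) = t"
    and w: "\<And>p q. \<lbrakk>p \<in> P; q \<in> P; same_orbit C (w p) (w q)\<rbrakk> \<Longrightarrow> p = q"
  shows "infinite (orbit_reps C t)"
proof -
  have "inj_on (\<lambda>p. orbit_rep C (w p)) P"
    using w by (auto intro!: inj_onI simp: orbit_rep_eq_iff[OF assms(1)])
  then have "infinite ((\<lambda>p. orbit_rep C (w p)) ` P)" using assms(2) finite_imageD by blast
  moreover have "(\<lambda>p. orbit_rep C (w p)) ` P \<subseteq> orbit_reps C t"
    using orbit_rep_in_orbit_reps[OF assms(1)] t by auto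
  ultimately show ?thesis using finite_subset by blast
qed

text \<open>The elements are triples \<open>(m, s, k)\<close>. On row \<open>0\<close> the triples \<open>((x, p), 0)\<close> with \<open>x\<close> of period
  \<open>p + 1\<close> in \<open>A\<close> carry a copy of the finite orbits of \<open>A\<close>. On a row \<open>m > 0\<close> the map leads from each
  stage \<open>s > 0\<close> at which \<open>m\<close> fires to the previous such stage, or to stage \<open>0\<close> if there is none, so
  that the orbit of \<open>(m, 0, 0)\<close> has no root iff \<open>m\<close> fires infinitely often. All other triples
  \<open>(m, s, k)\<close> are sent to \<open>(m, s, k + 1)\<close>.\<close>

definition node :: "nat \<Rightarrow> nat \<Rightarrow> nat \<Rightarrow> nat" where
  "node m s k = prod_encode (prod_encode (m, s), k)"

definition row :: "nat \<Rightarrow> nat" where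
  "row z = fst (prod_decode (fst (prod_decode z)))"

text \<open>Stage 0 is the end point of every row whether or not it fires; hence the guard
  \<open>0 < t\<close> and the default value 0.\<close>

definition previous_fire :: "(nat \<Rightarrow> nat \<Rightarrow> bool) \<Rightarrow> nat \<Rightarrow> nat \<Rightarrow> nat" where
  "previous_fire fire m s = rec_nat 0 (\<lambda>t r. if 0 < t \<and> fire m t then t else r) s"

text \<open>A correct guess on row 0, or a firing stage on another row. Where it fails, the element
  starts a chain of type \<open>\<omega>\<close> or is the start of its row.\<close>

definition jumps :: "(nat \<Rightarrow> nat) \<Rightarrow> (nat \<Rightarrow> nat \<Rightarrow> bool) \<Rightarrow> nat \<Rightarrow> nat \<Rightarrow> bool" where
  "jumps A fire m s \<longleftrightarrow> (if m = 0 then orbit_type A (fst (prod_decode s)) = Suc (Suc (snd (prod_decode s)))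
     else 0 < s \<and> fire m s)"

definition jump :: "(nat \<Rightarrow> nat) \<Rightarrow> (nat \<Rightarrow> nat \<Rightarrow> bool) \<Rightarrow> nat \<Rightarrow> nat \<Rightarrow> nat" where
  "jump A fire m s = (if m = 0 then prod_encode (A (fst (prod_decode s)), snd (prod_decode s))
     else previous_fire fire m s)"

definition rows :: "(nat \<Rightarrow> nat) \<Rightarrow> (nat \<Rightarrow> nat \<Rightarrow> bool) \<Rightarrow> nat \<Rightarrow> nat" where
  "rows A fire z = (let u = fst (prod_decode z); k = snd (prod_decode z);
       m = fst (prod_decode u); s = snd (prod_decode u) in
     if k = 0 \<and> jumps A fire m s then node m (jump A fire m s) 0 else node m s (Suc k))"

lemma rows_node:
  "rows A fire (node m s k) =
    (if k = 0 \<and> jumps A fire m s then node m (jump A fire m s) 0 else node m s (Suc k))"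
  by (simp add: rows_def node_def)

lemma row_node [simp]: "row (node m s k) = m"
  by (simp add: row_def node_def)

lemma node_eq_iff [simp]: "node m s k = node m' s' k' \<longleftrightarrow> m = m' \<and> s = s' \<and> k = k'"
  by (auto simp: node_def prod_encode_eq)

lemma node_cases: obtains m s k where "z = node m s k"
proof -
  obtain u k where "z = prod_encode (u, k)" by (metis prod_decode_inverse surj_pair)
  moreover obtain m s where "u = prod_encode (m, s)" by (metis prod_decode_inverse surj_pair)
  ultimately show thesis using that by (simp add: node_def)
qed

lemma previous_fire_Suc:
  "previous_fire fire m (Suc s) = (if 0 < s \<and> fire m s then s else previous_fire fire m s)"
  by (simp add: previous_fire_def)

lemma previous_fire_less: "0 < s \<Longrightarrow> previous_fire fire m s < s"
proof (induction s)
  case (Suc s)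
  then show ?case by (cases "s = 0") (auto simp: previous_fire_Suc previous_fire_def)
qed simp

lemma previous_fire_fires:
  "previous_fire fire m s = 0 \<or> 0 < previous_fire fire m s \<and> fire m (previous_fire fire m s)"
  by (induction s) (auto simp: previous_fire_Suc, auto simp: previous_fire_def)

lemma previous_fire_ge: "0 < t \<Longrightarrow> fire m t \<Longrightarrow> t < s \<Longrightarrow> t \<le> previous_fire fire m s"
  by (induction s) (auto simp: previous_fire_Suc less_Suc_eq)

lemma previous_fire_next:
  assumes "s = 0 \<or> fire m s" "s < s'" "fire m s'" "\<And>t. s < t \<Longrightarrow> t < s' \<Longrightarrow> \<not> fire m t"
  shows "previous_fire fire m s' = s"
proof -
  have "s \<le> previous_fire fire m s'"
    using assms(1,2) previous_fire_ge[of s fire m s'] by (cases "s = 0") auto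
  moreover have "previous_fire fire m s' < s'" using assms(2) by (intro previous_fire_less) simp
  ultimately show ?thesis
    using previous_fire_fires[of fire m s'] assms(4)[of "previous_fire fire m s'"]
    by (cases "s = previous_fire fire m s'") auto
qed

text \<open>On rows above 0: of two firing stages, the earlier one lies strictly after its own
  target, yet not after the target of the later one.\<close>

lemma jump_inj:
  assumes "inj A" "jumps A fire m s" "jumps A fire m t" "jump A fire m s = jump A fire m t"
  shows "s = t"
proof (cases "m = 0")
  case True
  then have "A (fst (prod_decode s)) = A (fst (prod_decode t))" "snd (prod_decode s) = snd (prod_decode t)"
    using assms(4) by (simp_all add: jump_def prod_encode_eq)
  then have "prod_decode s = prod_decode t" using assms(1) by (auto simp: prod_eq_iff dest: injD)
  then show ?thesis by (metis prod_decode_inverse)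
next
  case False
  have "previous_fire fire m a < previous_fire fire m b"
    if "a < b" "0 < a" "fire m a" for a b
    using previous_fire_less[of a fire m] previous_fire_ge[of a fire m b] that by simp
  then show ?thesis
    using assms(2-4) False by (cases s t rule: linorder_cases) (fastforce simp: jumps_def jump_def)+
qed

text \<open>The basis for reading orbits backwards: a node with \<open>k > 0\<close> can only be
  reached along its chain, one with \<open>k = 0\<close> only by a jump.\<close>

lemma rows_preimage:
  assumes "rows A fire w = node m s k"
  shows "k = 0 \<and> (\<exists>s'. w = node m s' 0 \<and> jumps A fire m s' \<and> jump A fire m s' = s) \<or>
    (\<exists>j. k = Suc j \<and> w = node m s j \<and> (0 < j \<or> \<not> jumps A fire m s))"
proof -
  obtain m' s' k' where w: "w = node m' s' k'" by (rule node_cases)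
  with assms show ?thesis by (auto simp: rows_node split: if_splits)
qed

lemma inj_rows:
  assumes "inj A" shows "inj (rows A fire)"
proof (rule injI)
  fix x y
  assume eq: "rows A fire x = rows A fire y"
  obtain m s k where z: "rows A fire x = node m s k" by (rule node_cases)
  from rows_preimage[OF z] rows_preimage[OF z[unfolded eq]] show "x = y"
    using jump_inj[OF assms] by auto
qed

context
  fixes A :: "nat \<Rightarrow> nat" and fire :: "nat \<Rightarrow> nat \<Rightarrow> bool"
  assumes inj: "inj A"
begin

abbreviation "N \<equiv> rows A fire"

lemma rows_chain:
  assumes "\<not> jumps A fire m s" shows "(N ^^ k) (node m s 0) = node m s k"
  using assms by (induction k) (simp_all add: rows_node)

lemma same_orbit_row_start:
  assumes "0 < m" "s = 0 \<or> jumps A fire m s" shows "same_orbit N (node m 0 0) (node m s 0)"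
  using assms(2)
proof (induction s rule: less_induct)
  case (less s)
  show ?case
  proof (cases "s = 0")
    case False
    then have j: "jumps A fire m s" using less.prems by simp
    let ?t = "previous_fire fire m s"
    have "?t < s" using False by (intro previous_fire_less) simp
    moreover have "?t = 0 \<or> jumps A fire m ?t"
      using previous_fire_fires[of fire m s] assms(1) by (auto simp: jumps_def)
    ultimately have "same_orbit N (node m 0 0) (node m ?t 0)" by (rule less.IH)
    moreover have "(N ^^ 1) (node m s 0) = node m ?t 0"
      using j assms(1) by (simp add: rows_node jump_def)
    then have "same_orbit N (node m ?t 0) (node m s 0)"
      using same_orbit_funpow same_orbit_sym by metis
    ultimately show ?thesis by (rule same_orbit_trans)
  qed (simp add: same_orbit_refl)
qed

text \<open>Classifies what is not of type \<open>\<omega>\<close>: only verified cycles on row 0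
  and, on each other row, the orbit of its start. Everything else is a wrong guess.\<close>

lemma rootless_node:
  assumes "orbit_type N (node m s k) \<noteq> 0"
  shows "m = 0 \<and> k = 0 \<and> jumps A fire m s \<or> 0 < m \<and> same_orbit N (node m 0 0) (node m s k)"
proof -
  have pre: "\<exists>w. N w = z \<and> orbit_type N w \<noteq> 0" if "orbit_type N z \<noteq> 0" for z
    using orbit_type_pos_range[OF that] that orbit_type_step[OF inj_rows[OF inj], of fire] by force
  have 1: "orbit_type N (node m s 0) \<noteq> 0 \<and> \<not> jumps A fire m s"
    if "orbit_type N (node m s k) \<noteq> 0" "0 < k" for k
    using that
  proof (induction k)
    case (Suc k)
    from pre[OF Suc.prems(1)] obtain w
      where w: "N w = node m s (Suc k)" "orbit_type N w \<noteq> 0" by blast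
    have "w = node m s k \<and> (0 < k \<or> \<not> jumps A fire m s)"
      using rows_preimage[OF w(1)] by auto
    then show ?case using Suc.IH w(2) by (cases "k = 0") auto
  qed simp
  \<comment> \<open>A node that does not jump but is the target of a jump is the start of a row: on
    row 0 the type is preserved, so targets jump again, and on other rows a target is stage 0 or
    fires.\<close>
  have 2: "0 < m \<and> s = 0" if "orbit_type N (node m s 0) \<noteq> 0" "\<not> jumps A fire m s"
  proof -
    from pre[OF that(1)] obtain w where "N w = node m s 0" by blast
    from rows_preimage[OF this] obtain s' where s': "jumps A fire m s'" "jump A fire m s' = s" by auto
    have "m \<noteq> 0"
    proof
      assume "m = 0"
      then have "jumps A fire m s"
        using s' orbit_type_step[OF inj] by (auto simp: jumps_def jump_def)
      with that(2) show False ..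
    qed
    moreover have "s = 0"
      using previous_fire_fires[of fire m s'] s' that(2) \<open>m \<noteq> 0\<close> by (auto simp: jumps_def jump_def)
    ultimately show ?thesis by simp
  qed
  show ?thesis
  proof (cases "jumps A fire m s")
    case True
    then have "k = 0" using 1 assms by (cases "k = 0") auto
    with True show ?thesis using same_orbit_row_start by (cases "m = 0") auto
  next
    case False
    then have "orbit_type N (node m s 0) \<noteq> 0" using 1[OF assms] assms by (cases "k = 0") auto
    from 2[OF this False] have "0 < m" "s = 0" by auto
    moreover have "same_orbit N (node m s 0) (node m s k)"
      using same_orbit_funpow[of N "node m s 0" k] rows_chain[OF False] by simp
    ultimately show ?thesis by simp
  qed
qed

lemma row_start_chain: "0 < m \<Longrightarrow> (N ^^ k) (node m 0 0) = node m 0 k"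
  by (intro rows_chain) (simp add: jumps_def)

lemma row_start_not_periodic: "0 < m \<Longrightarrow> orbit_type N (node m 0 0) = 0 \<or> orbit_type N (node m 0 0) = 1"
  using row_start_chain[of m "Suc k" for k] by (auto simp: orbit_type_def periodic_def simp del: funpow.simps)

lemma row_start_same_orbit:
  assumes "0 < m" "0 < m'" "same_orbit N (node m 0 0) (node m' 0 0)" shows "m = m'"
  using assms(3) row_start_chain[OF assms(1)] row_start_chain[OF assms(2)] by (auto simp: same_orbit_def)

text \<open>The last firing stage, or stage 0 if there is none, is the root: a preimage would be a
  later firing stage.\<close>

lemma row_start_type_0:
  assumes "0 < m" "finite {s. fire m s}" shows "orbit_type N (node m 0 0) = 0"
proof -
  define S where "S = insert 0 {s. 0 < s \<and> fire m s}"
  have S: "finite S" "S \<noteq> {}" unfolding S_def using assms(2) by auto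
  have "node m (Max S) 0 \<notin> range N"
  proof
    assume "node m (Max S) 0 \<in> range N"
    then obtain w where "N w = node m (Max S) 0" by force
    from rows_preimage[OF this] assms(1) obtain s
      where s: "0 < s" "fire m s" "previous_fire fire m s = Max S"
      by (auto simp: jumps_def jump_def)
    then have "s \<le> Max S" using S by (intro Max_ge) (auto simp: S_def)
    then show False using previous_fire_less[OF s(1), of fire m] s(3) by simp
  qed
  then have "orbit_type N (node m (Max S) 0) = 0" by (rule orbit_type_not_range)
  moreover have "Max S \<in> S" using S by (rule Max_in)
  then have "same_orbit N (node m 0 0) (node m (Max S) 0)"
    using assms(1) by (intro same_orbit_row_start) (auto simp: S_def jumps_def)
  ultimately show ?thesis using same_orbit_orbit_type[OF inj_rows[OF inj]] by metis
qed

text \<open>Going backwards from the start meets only stage 0 and firing stages, and each of these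
  is the target of the next firing stage.\<close>

lemma row_start_type_1:
  assumes "0 < m" "infinite {s. fire m s}" shows "orbit_type N (node m 0 0) = 1"
proof -
  have "\<not> rooted N (node m 0 0)"
  proof
    assume "rooted N (node m 0 0)"
    then obtain r n where r: "r \<notin> range N" "(N ^^ n) r = node m 0 0" by (auto simp: rooted_def)
    have "(N ^^ n) r = node m s 0 \<Longrightarrow> s = 0 \<or> jumps A fire m s \<Longrightarrow>
        \<exists>s. r = node m s 0 \<and> (s = 0 \<or> jumps A fire m s)" for s n
    proof (induction n arbitrary: s)
      case (Suc n)
      from rows_preimage[of A fire "(N ^^ n) r" m s 0] Suc.prems(1) obtain s'
        where "(N ^^ n) r = node m s' 0" "jumps A fire m s'" by auto
      then show ?case using Suc.IH by blast
    qed auto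
    from this[OF r(2)] obtain s where s: "r = node m s 0" "s = 0 \<or> fire m s"
      using assms(1) by (auto simp: jumps_def)
    obtain t where "s < t" "fire m t" using assms(2) unfolding infinite_nat_iff_unbounded by auto
    then have ex: "\<exists>t. s < t \<and> fire m t" by blast
    define t where "t = (LEAST t. s < t \<and> fire m t)"
    have t: "s < t" "fire m t" using LeastI_ex[OF ex] unfolding t_def by auto
    have "\<not> fire m u" if "s < u" "u < t" for u
      using not_less_Least[of u "\<lambda>t. s < t \<and> fire m t"] that unfolding t_def by blast
    then have "previous_fire fire m t = s" using s(2) t by (intro previous_fire_next)
    then have "N (node m t 0) = r"
      using t assms(1) s(1) by (simp add: rows_node jumps_def jump_def)
    with r(1) show False by blast
  qed
  then have "orbit_type N (node m 0 0) \<noteq> 0" by (simp add: orbit_type_def)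
  with row_start_not_periodic[OF assms(1)] show ?thesis by simp
qed

lemma cycle_node:
  assumes "orbit_type A x = Suc (Suc p)"
  shows "(N ^^ n) (node 0 (prod_encode (x, p)) 0) = node 0 (prod_encode ((A ^^ n) x, p)) 0"
proof (induction n)
  case (Suc n)
  have "orbit_type A ((A ^^ n) x) = Suc (Suc p)" using assms orbit_type_funpow[OF inj] by metis
  then show ?case by (simp add: Suc rows_node jumps_def jump_def)
qed simp

lemma orbit_type_cycle_node:
  assumes "orbit_type A x = Suc (Suc p)"
  shows "orbit_type N (node 0 (prod_encode (x, p)) 0) = Suc (Suc p)"
  using assms unfolding orbit_type_eq_Suc_Suc_iff cycle_node[OF assms]
  by (simp add: prod_encode_eq del: funpow.simps)

text \<open>Any element of an orbit of type \<int> reveals, by mere decoding, the one row to which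
  the orbit belongs.\<close>

lemma orbit_type_1_row:
  assumes "orbit_type N z = 1"
  shows "0 < row z" "infinite {s. fire (row z) s}" "same_orbit N (node (row z) 0 0) z"
proof -
  obtain m s k where z: "z = node m s k" by (rule node_cases)
  have "\<not> (m = 0 \<and> k = 0 \<and> jumps A fire m s)"
  proof
    assume *: "m = 0 \<and> k = 0 \<and> jumps A fire m s"
    obtain x p where s: "s = prod_encode (x, p)" by (metis prod_decode_inverse surj_pair)
    then have "orbit_type A x = Suc (Suc p)" using * by (auto simp: jumps_def)
    from orbit_type_cycle_node[OF this] show False using * assms z s by simp
  qed
  then have m: "0 < m" "same_orbit N (node m 0 0) z" using rootless_node[of m s k] assms z by auto
  then have "orbit_type N (node m 0 0) = 1"
    using assms same_orbit_orbit_type[OF inj_rows[OF inj]] by metis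
  then have "infinite {s. fire m s}" using row_start_type_0[OF m(1)] by auto
  with m z show "0 < row z" "infinite {s. fire (row z) s}" "same_orbit N (node (row z) 0 0) z"
    by auto
qed

lemma orbit_type_cycle:
  assumes "orbit_type N z = Suc (Suc p)"
  obtains x where "z = node 0 (prod_encode (x, p)) 0" "orbit_type A x = Suc (Suc p)"
proof -
  obtain m s k where z: "z = node m s k" by (rule node_cases)
  have "\<not> (0 < m \<and> same_orbit N (node m 0 0) z)"
    using row_start_not_periodic[of m] same_orbit_orbit_type[OF inj_rows[OF inj], of fire "node m 0 0" z] assms
    by auto
  then have *: "m = 0" "k = 0" "jumps A fire m s" using rootless_node[of m s k] assms z by auto
  obtain x q where s: "s = prod_encode (x, q)" by (metis prod_decode_inverse surj_pair)
  then have t: "orbit_type A x = Suc (Suc q)" using * by (simp add: jumps_def)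
  then have "p = q" using orbit_type_cycle_node[OF t] assms z s * by simp
  then show thesis using that z s t * by simp
qed

text \<open>The element 0 has at most one period, so all but at most one of the guesses
  \<open>(0, p)\<close> on row 0 are wrong, and each wrong one has an orbit of its own.\<close>

lemma infinite_orbit_reps_rows_0: "infinite (orbit_reps N 0)"
proof (rule infinite_orbit_reps[where w = "\<lambda>p. node 0 (prod_encode (0, p)) 0"])
  let ?P = "{p. orbit_type A 0 \<noteq> Suc (Suc p)}"
  have "- ?P \<subseteq> {orbit_type A 0 - 2}" by auto
  then have "finite (- ?P)" using finite_subset by blast
  then show "infinite ?P" using finite_Un[of ?P "- ?P"] by (auto simp: Compl_partition)
  have nj: "\<not> jumps A fire 0 (prod_encode (0, p))" if "p \<in> ?P" for p
    using that by (simp add: jumps_def)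
  show "orbit_type N (node 0 (prod_encode (0, p)) 0) = 0" if "p \<in> ?P" for p
    using rootless_node[of 0 "prod_encode (0, p)" 0] nj[OF that] by auto
  show "p = q" if "p \<in> ?P" "q \<in> ?P" "same_orbit N (node 0 (prod_encode (0, p)) 0) (node 0 (prod_encode (0, q)) 0)"
    for p q
    using that(3) rows_chain[OF nj[OF that(1)]] rows_chain[OF nj[OF that(2)]]
    by (auto simp: same_orbit_def prod_encode_eq)
qed (rule inj_rows[OF inj])

lemma infinite_orbit_reps_rows_1:
  assumes "infinite {m. 0 < m \<and> infinite {s. fire m s}}" shows "infinite (orbit_reps N 1)"
  by (rule infinite_orbit_reps[OF inj_rows[OF inj] assms, where w = "\<lambda>m. node m 0 0"])
    (use row_start_type_1 row_start_same_orbit in auto)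

text \<open>Both infinite types occur infinitely often on either side, so only the cycles need
  explicit embeddings: pairing with the period, and decoding.\<close>

lemma rows_isomorphic:
  assumes "infinite (orbit_reps A 0)" "infinite (orbit_reps A 1)"
    and "infinite {m. 0 < m \<and> infinite {s. fire m s}}"
  shows "isomorphic N A"
proof -
  have AN: "orbits_embed A N t" for t
  proof -
    consider "t = 0" | "t = 1" | p where "t = Suc (Suc p)" by (metis One_nat_def not0_implies_Suc)
    then show ?thesis
    proof cases
      case 1
      show ?thesis unfolding 1 by (rule orbits_embed_infinite[OF infinite_orbit_reps_rows_0])
    next
      case 2
      show ?thesis unfolding 2 by (rule orbits_embed_infinite[OF infinite_orbit_reps_rows_1[OF assms(3)]])
    next
      case 3
      show ?thesis
      proof (rule orbits_embedI[OF inj inj_rows[OF inj], where e = "\<lambda>x. node 0 (prod_encode (x, p)) 0"])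
        show "orbit_type N (node 0 (prod_encode (x, p)) 0) = t" if "orbit_type A x = t" for x
          using orbit_type_cycle_node that 3 by simp
        show "same_orbit A x y" if "orbit_type A x = t" "orbit_type A y = t"
          "same_orbit N (node 0 (prod_encode (x, p)) 0) (node 0 (prod_encode (y, p)) 0)" for x y
          using that cycle_node[of x p] cycle_node[of y p] 3
          by (auto simp: same_orbit_def prod_encode_eq)
      qed
    qed
  qed
  have NA: "orbits_embed N A t" for t
  proof -
    consider "t = 0" | "t = 1" | p where "t = Suc (Suc p)" by (metis One_nat_def not0_implies_Suc)
    then show ?thesis
    proof cases
      case 1
      show ?thesis unfolding 1 by (rule orbits_embed_infinite[OF assms(1)])
    next
      case 2
      show ?thesis unfolding 2 by (rule orbits_embed_infinite[OF assms(2)])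
    next
      case 3
      define e where "e = (\<lambda>z. fst (prod_decode (snd (prod_decode (fst (prod_decode z))))))"
      have e: "e (node 0 (prod_encode (x, q)) 0) = x" for x q by (simp add: e_def node_def)
      show ?thesis
      proof (rule orbits_embedI[OF inj_rows[OF inj] inj, where e = e])
        show "orbit_type A (e z) = t" if "orbit_type N z = t" for z
          using that unfolding 3 by (rule orbit_type_cycle) (simp add: e)
        show "same_orbit N z z'" if zz': "orbit_type N z = t" "orbit_type N z' = t" "same_orbit A (e z) (e z')"
          for z z'
        proof -
          obtain x where x: "z = node 0 (prod_encode (x, p)) 0" "orbit_type A x = Suc (Suc p)"
            using zz'(1) unfolding 3 by (rule orbit_type_cycle)
          obtain y where y: "z' = node 0 (prod_encode (y, p)) 0" "orbit_type A y = Suc (Suc p)"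
            using zz'(2) unfolding 3 by (rule orbit_type_cycle)
          show ?thesis
            using zz'(3) unfolding x(1) y(1) e same_orbit_def cycle_node[OF x(2)] cycle_node[OF y(2)]
            by auto
        qed
      qed
    qed
  qed
  show ?thesis
    unfolding isomorphic_def using isomorphism_orbit_match[OF inj_rows[OF inj] inj NA AN] by blast
qed

end

section \<open>Punctuality of the copies\<close>

lemma pr_node [pr_intros]: "pr X k m \<Longrightarrow> pr X k s \<Longrightarrow> pr X k j \<Longrightarrow> pr X k (\<lambda>xs. node (m xs) (s xs) (j xs))"
  unfolding node_def by (intro pr_prod_encode)

lemma pr_row [pr_intros]: "pr X k z \<Longrightarrow> pr X k (\<lambda>xs. row (z xs))"
  unfolding row_def by (intro pr_fst_prod_decode)

lemma punctual_rows:
  assumes A: "punctual A" and fire: "prP {} 2 (\<lambda>xs. fire (xs ! 0) (xs ! 1))"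
  shows "punctual (rows A fire)"
proof -
  have A1: "pr {} 1 (\<lambda>xs. A (xs ! 0))" using A by (simp add: punctual_iff)
  have pA: "pr {} k (\<lambda>xs. A (a xs))" if "pr {} k a" for k a
    using pr_comp[OF A1 prl_Cons[OF that prl_Nil]] by simp
  have pf: "prP {} k (\<lambda>xs. fire (a xs) (b xs))" if "pr {} k a" "pr {} k b" for k a b
    using prP_comp[OF fire prl_Cons[OF that(1) prl_Cons[OF that(2) prl_Nil]]] by simp
  have "pr {} 2 (\<lambda>xs. previous_fire fire (xs ! 0) (xs ! 1))"
    unfolding previous_fire_def by (rule pr_rec pr_intros pf | simp)+
  from pr_comp[OF this prl_Cons[OF _ prl_Cons[OF _ prl_Nil]]]
  have pp: "pr {} k (\<lambda>xs. previous_fire fire (a xs) (b xs))" if "pr {} k a" "pr {} k b" for k a b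
    using that by fastforce
  have "prP {} 2 (\<lambda>xs. (A ^^ Suc (xs ! 1)) (xs ! 0) = xs ! 0 \<and>
      (\<forall>q<xs ! 1. (A ^^ Suc q) (xs ! 0) \<noteq> xs ! 0))"
    by (rule pr_funpow[OF A1] pr_intros | simp only: | simp del: funpow.simps)+
  then have "prP {} 2 (\<lambda>xs. orbit_type A (xs ! 0) = Suc (Suc (xs ! 1)))"
    by (simp only: orbit_type_eq_Suc_Suc_iff)
  from prP_comp[OF this prl_Cons[OF _ prl_Cons[OF _ prl_Nil]]]
  have po: "prP {} k (\<lambda>xs. orbit_type A (a xs) = Suc (Suc (b xs)))" if "pr {} k a" "pr {} k b" for k a b
    using that by fastforce
  \<comment> \<open>\<open>pr_if\<close> covers numerical conditionals only, so boolean ones are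
    first expanded into connectives.\<close>
  have if_eq: "(if P then Q else R) \<longleftrightarrow> (P \<and> Q) \<or> (\<not> P \<and> R)" for P Q R by simp
  show ?thesis
    unfolding punctual_iff rows_def Let_def jumps_def jump_def if_eq
    by (rule po pp pA pf pr_intros | simp)+
qed



section \<open>Coding \<open>\<Delta>\<^sup>0\<^sub>3\<close> functions\<close>

text \<open>A number is read as nested pairs without end, so every index has an entry and no length
  has to be stored.\<close>

definition entry :: "nat \<Rightarrow> nat \<Rightarrow> nat" where
  "entry c i = fst (prod_decode (((\<lambda>z. snd (prod_decode z)) ^^ i) c))"

lemma ex_entries: "\<exists>c. \<forall>i<n. entry c i = v i"
proof (induction n arbitrary: v)
  case (Suc n)
  obtain c where c: "\<forall>i<n. entry c i = v (Suc i)" using Suc.IH[of "\<lambda>i. v (Suc i)"] by blast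
  have "entry (prod_encode (v 0, c)) i = v i" if "i < Suc n" for i
    using that c by (cases i) (simp_all add: entry_def funpow_Suc_right del: funpow.simps(2))
  then show ?case by blast
qed simp

lemma pr_entry [pr_intros]:
  assumes "pr X k c" "pr X k i" shows "pr X k (\<lambda>xs. entry (c xs) (i xs))"
proof -
  have "pr X 1 (\<lambda>xs. snd (prod_decode (xs ! 0)))" by (rule pr_intros | simp)+
  then show ?thesis unfolding entry_def using assms by (intro pr_fst_prod_decode pr_funpow)
qed

section \<open>Infinitely often as a normal form for \<open>\<Pi>\<^sup>0\<^sub>2\<close>\<close>

text \<open>The length of the longest initial segment, up to the stage, all of whose members have
  witnesses below the stage.\<close>

definition progress :: "(nat \<Rightarrow> nat \<Rightarrow> bool) \<Rightarrow> nat \<Rightarrow> nat" where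
  "progress S s = (LEAST z. \<not> (\<exists>w<s. S w z) \<or> s \<le> z)"

lemma progress_ge_iff: "n \<le> progress S s \<longleftrightarrow> n \<le> s \<and> (\<forall>z<n. \<exists>w<s. S w z)"
proof
  assume n: "n \<le> progress S s"
  have "progress S s \<le> s" unfolding progress_def by (rule Least_le) simp
  moreover have "\<exists>w<s. S w z" if "z < n" for z
    using not_less_Least[of z "\<lambda>z. \<not> (\<exists>w<s. S w z) \<or> s \<le> z"] that n unfolding progress_def by auto
  ultimately show "n \<le> s \<and> (\<forall>z<n. \<exists>w<s. S w z)" using n by auto
next
  assume n: "n \<le> s \<and> (\<forall>z<n. \<exists>w<s. S w z)"
  have "\<not> (\<exists>w<s. S w (progress S s)) \<or> s \<le> progress S s"
    unfolding progress_def using LeastI[of "\<lambda>z. \<not> (\<exists>w<s. S w z) \<or> s \<le> z" s] by simp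
  then show "n \<le> progress S s" using n by (metis linorder_not_le order_trans)
qed

text \<open>Progress is monotone in the stage, so it grows infinitely often iff it is unbounded,
  that is, iff every \<open>z\<close> receives a witness eventually.\<close>

lemma infinite_progress_iff:
  "infinite {s. progress S s < progress S (Suc s)} \<longleftrightarrow> (\<forall>z. \<exists>w. S w z)"
proof
  have mono: "progress S s \<le> progress S t" if "s \<le> t" for s t
    using progress_ge_iff[of "progress S s" S s] progress_ge_iff[of "progress S s" S t] that
    by (meson order_refl order_trans less_le_trans)
  {
    assume inf: "infinite {s. progress S s < progress S (Suc s)}"
    have "\<exists>s. n \<le> progress S s" for n
    proof (induction n)
      case (Suc n)
      then obtain s where s: "n \<le> progress S s" ..
      obtain t where t: "s \<le> t" "progress S t < progress S (Suc t)"
        using inf unfolding infinite_nat_iff_unbounded_le by blast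
      with s mono[OF t(1)] have "Suc n \<le> progress S (Suc t)" by simp
      then show ?case ..
    qed simp
    then show "\<forall>z. \<exists>w. S w z" using progress_ge_iff[of "Suc z" S for z] by (meson lessI)
  next
    assume all: "\<forall>z. \<exists>w. S w z"
    show "infinite {s. progress S s < progress S (Suc s)}"
    proof
      assume "finite {s. progress S s < progress S (Suc s)}"
      then obtain b where "\<forall>s\<in>{s. progress S s < progress S (Suc s)}. s < b"
        using finite_nat_set_iff_bounded by blast
      then have b: "progress S (Suc s) \<le> progress S s" if "b \<le> s" for s
        using that by (metis linorder_not_le mem_Collect_eq)
      have bound: "progress S (b + k) \<le> progress S b" for k
        using b[of "b + k" for k] by (induction k) (auto intro: order_trans)
      obtain w where w: "S (w z) z" for z using all by metis
      define n where "n = Suc (progress S b)"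
      \<comment> \<open>A stage beyond \<open>b\<close> and beyond the witnesses of all
        \<open>z < n\<close>, where \<open>n\<close> exceeds the value at which progress supposedly
        stalls.\<close>
      define s where "s = b + n + Suc (Max (w ` {..n}))"
      have "w z < s" if "z < n" for z
      proof -
        have "w z \<le> Max (w ` {..n})" using that by (intro Max_ge) auto
        then show ?thesis by (simp add: s_def)
      qed
      then have "n \<le> progress S s"
        unfolding progress_ge_iff using w by (auto simp: s_def)
      moreover have "progress S s \<le> progress S b"
        using bound[of "n + Suc (Max (w ` {..n}))"] by (simp add: s_def add.assoc)
      ultimately show False by (simp add: n_def)
    qed
  }
qed

text \<open>If some \<open>g y\<close> holds at infinitely many stages, then exactly one \<open>(y, u)\<close> makes
  \<open>guarded_fire g y u\<close> hold at infinitely many stages: \<open>y\<close> is the least such index and \<open>u\<close> the last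
  stage at which a smaller index is active. This turns a \<open>\<Sigma>\<^sup>0\<^sub>3\<close> condition into a \<open>\<Pi>\<^sup>0\<^sub>2\<close> condition with
  a unique witness.\<close>

definition guarded_fire :: "(nat \<Rightarrow> nat \<Rightarrow> bool) \<Rightarrow> nat \<Rightarrow> nat \<Rightarrow> nat \<Rightarrow> bool" where
  "guarded_fire g y u s \<longleftrightarrow> u < s \<and> g y s \<and> (\<forall>y'<y. \<forall>t<Suc s. u < t \<longrightarrow> \<not> g y' t) \<and>
     (u = 0 \<or> (\<exists>y'<y. g y' u))"

lemma guarded_fire_infiniteD:
  assumes "infinite {s. guarded_fire g y u s}"
  shows "infinite {s. g y s}" "\<And>y' t. y' < y \<Longrightarrow> u < t \<Longrightarrow> \<not> g y' t" "u = 0 \<or> (\<exists>y'<y. g y' u)"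
proof -
  have "{s. guarded_fire g y u s} \<subseteq> {s. g y s}" by (auto simp: guarded_fire_def)
  then show "infinite {s. g y s}" using assms finite_subset by blast
  show "\<not> g y' t" if "y' < y" "u < t" for y' t
  proof -
    obtain s where "t \<le> s" "guarded_fire g y u s"
      using assms unfolding infinite_nat_iff_unbounded_le by blast
    then show ?thesis using that by (auto simp: guarded_fire_def less_Suc_eq_le)
  qed
  obtain s where "guarded_fire g y u s" using assms unfolding infinite_nat_iff_unbounded by blast
  then show "u = 0 \<or> (\<exists>y'<y. g y' u)" by (auto simp: guarded_fire_def)
qed

text \<open>The smaller of two indices would be active beyond the guard of the larger. With equal
  indices, the later guard would itself be a stage of forbidden activity after the earlier
  guard.\<close>

lemma guarded_fire_unique:
  assumes "infinite {s. guarded_fire g y u s}" "infinite {s. guarded_fire g y' u' s}"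
  shows "y = y' \<and> u = u'"
proof -
  have "\<not> y < y'" if "infinite {s. guarded_fire g y u s}" "infinite {s. guarded_fire g y' u' s}" for y u y' u'
  proof
    assume "y < y'"
    then have "{s. g y s} \<subseteq> {..u'}"
      using guarded_fire_infiniteD(2)[OF that(2)] by (auto simp: not_less[symmetric])
    then have "finite {s. g y s}" using finite_subset by blast
    with guarded_fire_infiniteD(1)[OF that(1)] show False ..
  qed
  from this[OF assms] this[OF assms(2,1)] have y: "y = y'" by simp
  have "\<not> u < u'" if "infinite {s. guarded_fire g y u s}" "infinite {s. guarded_fire g y u' s}" for u u'
    using guarded_fire_infiniteD(2)[OF that(1)] guarded_fire_infiniteD(3)[OF that(2)] by auto
  from this[OF assms(1) assms(2)[folded y]] this[OF assms(2)[folded y] assms(1)] y show ?thesis by simp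
qed

lemma guarded_fire_ex:
  assumes "infinite {s. g y s}" shows "\<exists>y u. infinite {s. guarded_fire g y u s}"
proof -
  define m where "m = (LEAST y. infinite {s. g y s})"
  have m: "infinite {s. g m s}" "\<And>y. y < m \<Longrightarrow> finite {s. g y s}"
    using LeastI[of "\<lambda>y. infinite {s. g y s}", OF assms] not_less_Least[of _ "\<lambda>y. infinite {s. g y s}"]
    unfolding m_def by blast+
  \<comment> \<open>All stages at which a smaller index is active. The extra 0 supplies the maximum
    if there are none, in accordance with the clause \<open>u = 0\<close>.\<close>
  define U where "U = insert 0 (\<Union>y<m. {s. g y s})"
  have U: "finite U" "U \<noteq> {}" unfolding U_def using m(2) by auto
  define u where "u = Max U"
  have "u \<in> U" unfolding u_def using U by (rule Max_in)
  then have u0: "u = 0 \<or> (\<exists>y<m. g y u)" by (auto simp: U_def)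
  have "\<not> g y t" if "y < m" "u < t" for y t
    using that Max_ge[OF U(1), of t] by (auto simp: U_def u_def)
  then have "{s. g m s} - {..u} \<subseteq> {s. guarded_fire g m u s}"
    using u0 by (auto simp: guarded_fire_def)
  moreover have "infinite ({s. g m s} - {..u})" using m(1) by simp
  ultimately show ?thesis using finite_subset by blast
qed

text \<open>A row \<open>m + 1\<close> stands for \<open>m = (x, (y, u))\<close>, where \<open>y\<close> codes the values \<open>f 0, \<dots>, f x\<close> together
  with \<open>\<Sigma>\<^sup>0\<^sub>3\<close> witnesses for them.\<close>

lemma Sigma0_in_3_graph_rows:
  assumes "Sigma0_in {} 3 2 (\<lambda>xs. f (xs ! 0) = xs ! 1)"
  obtains fire ind val where
    "prP {} 2 (\<lambda>xs. fire (xs ! 0) (xs ! 1))"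
    "pr {} 1 (\<lambda>xs. ind (xs ! 0))" "pr {} 2 (\<lambda>xs. val (xs ! 0) (xs ! 1))"
    "\<forall>x. \<exists>m>0. infinite {s. fire m s} \<and> ind m = x"
    "inj_on ind {m. 0 < m \<and> infinite {s. fire m s}}"
    "\<forall>m i. infinite {s. fire m s} \<longrightarrow> i \<le> ind m \<longrightarrow> val m i = f i"
proof -
  obtain R where R: "prP {} (2 + 3) R"
    "\<And>xs. length xs = 2 \<Longrightarrow> (f (xs ! 0) = xs ! 1) = (\<exists>y. \<forall>z. \<exists>w. R (w # z # y # xs))"
    using Sigma0_in_3_normal_form[OF assms] by blast
  have R2: "f x = v \<longleftrightarrow> (\<exists>y. \<forall>z. \<exists>w. R [w, z, y, x, v])" for x v
    using R(2)[of "[x, v]"] by simp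
  \<comment> \<open>\<open>z\<close> is split as \<open>(i, z')\<close>, so that one universal
    quantifier serves all \<open>i \<le> x\<close> at once; \<open>i > x\<close> imposes nothing.
    The first half of \<open>y\<close> codes the values, the second half the witnesses.\<close>
  define S where "S = (\<lambda>x y w z. let i = fst (prod_decode z) in i \<le> x \<longrightarrow>
    R [w, snd (prod_decode z), entry (snd (prod_decode y)) i, i, entry (fst (prod_decode y)) i])"
  define g where "g = (\<lambda>x y s. progress (S x y) s < progress (S x y) (Suc s))"
  have inf_g: "infinite {s. g x y s} \<longleftrightarrow>
    (\<forall>i\<le>x. \<forall>z. \<exists>w. R [w, z, entry (snd (prod_decode y)) i, i, entry (fst (prod_decode y)) i])" for x y
  proof -
    have "infinite {s. g x y s} \<longleftrightarrow> (\<forall>z. \<exists>w. S x y w z)"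
      unfolding g_def by (rule infinite_progress_iff)
    also have "\<dots> \<longleftrightarrow> (\<forall>i z. \<exists>w. S x y w (prod_encode (i, z)))"
      by (metis prod_decode_inverse surj_pair)
    finally show ?thesis by (simp add: S_def Let_def)
  qed
  have ex: "\<exists>y. infinite {s. g x y s}" for x
  proof -
    have "\<forall>i. \<exists>y. \<forall>z. \<exists>w. R [w, z, y, i, f i]" using R2 by blast
    then obtain wit where wit: "\<forall>z. \<exists>w. R [w, z, wit i, i, f i]" for i by metis
    obtain c where c: "\<forall>i<Suc x. entry c i = f i" using ex_entries by blast
    obtain d where d: "\<forall>i<Suc x. entry d i = wit i" using ex_entries by blast
    have "infinite {s. g x (prod_encode (c, d)) s}" unfolding inf_g using c d wit by simp
    then show ?thesis ..
  qed
  have val: "entry (fst (prod_decode y)) i = f i" if "infinite {s. g x y s}" "i \<le> x" for x y i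
    using that R2 unfolding inf_g by metis
  \<comment> \<open>Row 0 is reserved for the cycles, hence the shift \<open>m - 1\<close>.\<close>
  define ind where "ind = (\<lambda>m. fst (prod_decode (m - 1)))"
  define yy where "yy = (\<lambda>m. fst (prod_decode (snd (prod_decode (m - 1)))))"
  define uu where "uu = (\<lambda>m. snd (prod_decode (snd (prod_decode (m - 1)))))"
  define fire where "fire = (\<lambda>m s. guarded_fire (g (ind m)) (yy m) (uu m) s)"
  show thesis
  proof
    show "pr {} 1 (\<lambda>xs. ind (xs ! 0))"
      unfolding ind_def by (rule pr_intros | simp)+
    show "pr {} 2 (\<lambda>xs. entry (fst (prod_decode (yy (xs ! 0)))) (xs ! 1))"
      unfolding yy_def by (rule pr_intros | simp)+
    have pS: "prP {} k (\<lambda>xs. S (x xs) (y xs) (w xs) (z xs))"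
      if "pr {} k x" "pr {} k y" "pr {} k w" "pr {} k z" for k x y w z
      unfolding S_def Let_def by (rule that pr_intros prP_comp[OF R(1)] | simp)+
    have "pr {} 3 (\<lambda>xs. progress (S (xs ! 0) (xs ! 1)) (xs ! 2))"
      unfolding progress_def by (rule pS pr_intros | simp)+
    from pr_comp[OF this prl_Cons[OF _ prl_Cons[OF _ prl_Cons[OF _ prl_Nil]]]]
    have pp: "pr {} k (\<lambda>xs. progress (S (x xs) (y xs)) (s xs))"
      if "pr {} k x" "pr {} k y" "pr {} k s" for k x y s
      using that by fastforce
    show "prP {} 2 (\<lambda>xs. fire (xs ! 0) (xs ! 1))"
      unfolding fire_def guarded_fire_def g_def ind_def yy_def uu_def
      by (rule pp pr_intros | simp)+
    show "\<forall>x. \<exists>m>0. infinite {s. fire m s} \<and> ind m = x"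
    proof
      fix x
      obtain y u where "infinite {s. guarded_fire (g x) y u s}" using ex guarded_fire_ex by metis
      then have "infinite {s. fire (Suc (prod_encode (x, prod_encode (y, u)))) s}"
        by (simp add: fire_def ind_def yy_def uu_def)
      moreover have "ind (Suc (prod_encode (x, prod_encode (y, u)))) = x" by (simp add: ind_def)
      ultimately show "\<exists>m>0. infinite {s. fire m s} \<and> ind m = x" by blast
    qed
    show "inj_on ind {m. 0 < m \<and> infinite {s. fire m s}}"
    proof (rule inj_onI, clarify)
      fix m n
      assume m: "0 < m" "infinite {s. fire m s}" and n: "0 < n" "infinite {s. fire n s}"
        and eq: "ind m = ind n"
      have "yy m = yy n \<and> uu m = uu n"
        using m(2) n(2) guarded_fire_unique unfolding fire_def eq by blast
      then have "prod_decode (m - 1) = prod_decode (n - 1)"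
        using eq unfolding ind_def yy_def uu_def
        by (metis prod.collapse prod_decode_inverse)
      then have "m - 1 = n - 1" by (metis prod_decode_inverse)
      then show "m = n" using m n by simp
    qed
    have "entry (fst (prod_decode (yy m))) i = f i" if "infinite {s. fire m s}" "i \<le> ind m" for m i
      using val[OF guarded_fire_infiniteD(1)[OF that(1)[unfolded fire_def]] that(2)] .
    then show "\<forall>m i. infinite {s. fire m s} \<longrightarrow> i \<le> ind m \<longrightarrow> entry (fst (prod_decode (yy m))) i = f i"
      by blast
  qed
qed

lemma PR_reducible_fun_comp:
  assumes "f \<le>PR d" "g \<le>PR d" shows "(\<lambda>x. f (g x)) \<le>PR d"
  using pr_comp[OF assms(1)[unfolded PR_reducible_iff] prl_Cons[OF assms(2)[unfolded PR_reducible_iff] prl_Nil]]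
  by (simp add: PR_reducible_iff)

lemma PRCatSpec_subset_Cone_Delta0_3:
  assumes A: "punctual A" "inj A"
    and inf: "infinite (orbit_reps A 0)" "infinite (orbit_reps A 1)"
  shows "PRCatSpec A \<subseteq> Cone_Delta0 3"
proof
  fix d
  assume d: "d \<in> PRCatSpec A"
  then have deg: "d \<in> PR_degrees" by (simp add: PRCatSpec_def)
  then obtain c where c: "\<And>f. below_degree f d \<longleftrightarrow> f \<le>PR c" using PR_degrees_generator by blast
  have "f \<le>PR c" if f: "Delta0_fun_in {} 3 f" for f
  proof -
    from f have "Sigma0_in {} 3 2 (\<lambda>xs. f (xs ! 0) = xs ! 1)"
      by (simp add: Delta0_fun_in_def Delta0_in_def)
    then obtain fire ind val where fire: "prP {} 2 (\<lambda>xs. fire (xs ! 0) (xs ! 1))"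
      and ind: "pr {} 1 (\<lambda>xs. ind (xs ! 0))" and val: "pr {} 2 (\<lambda>xs. val (xs ! 0) (xs ! 1))"
      and ex: "\<forall>x. \<exists>m>0. infinite {s. fire m s} \<and> ind m = x"
      and inj: "inj_on ind {m. 0 < m \<and> infinite {s. fire m s}}"
      and f: "\<forall>m i. infinite {s. fire m s} \<longrightarrow> i \<le> ind m \<longrightarrow> val m i = f i"
      by (rule Sigma0_in_3_graph_rows)
    \<comment> \<open>If every stage fires, each row \<open>m > 0\<close> carries an orbit of type
      \<int>, and the starts of the rows list representatives of different ones.\<close>
    let ?all = "\<lambda>(m::nat) (s::nat). True"
    define B1 where "B1 = rows A ?all"
    define B2 where "B2 = rows A fire"
    note inj_B = inj_rows[OF A(2)]
    have "{m::nat. 0 < m} = {0<..}" by auto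
    then have inf1: "infinite {m::nat. 0 < m \<and> infinite {s::nat. True}}"
      using infinite_Ioi[of "0::nat"] by simp
    have "x \<in> ind ` {m. 0 < m \<and> infinite {s. fire m s}}" for x
      using ex[rule_format, of x] by blast
    then have "ind ` {m. 0 < m \<and> infinite {s. fire m s}} = UNIV" by blast
    then have inf2: "infinite {m. 0 < m \<and> infinite {s. fire m s}}"
      by (metis finite_imageI infinite_UNIV_nat)
    have "punctual B1" "isomorphic B1 A"
      unfolding B1_def using punctual_rows[OF A(1) prP_const] rows_isomorphic[OF A(2) inf inf1] by auto
    then obtain h1 where h1: "isomorphism A B1 h1" "h1 \<le>PR c" "inv h1 \<le>PR c"
      using d c unfolding PRCatSpec_def by blast
    have "punctual B2" "isomorphic B2 A"
      unfolding B2_def using punctual_rows[OF A(1) fire] rows_isomorphic[OF A(2) inf inf2] by auto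
    then obtain h2 where h2: "isomorphism A B2 h2" "h2 \<le>PR c" "inv h2 \<le>PR c"
      using d c unfolding PRCatSpec_def by blast
    \<comment> \<open>The composite map from \<open>B1\<close> through \<open>A\<close> to
      \<open>B2\<close> takes the inverse of one isomorphism and the forward direction of the other;
      the spectrum provides both below \<open>c\<close>.\<close>
    define z where "z = (\<lambda>j. h2 (inv h1 (node (Suc j) 0 0)))"
    have "(\<lambda>x. h2 (inv h1 x)) \<le>PR c" by (rule PR_reducible_fun_comp[OF h2(2) h1(3)])
    then have ph: "pr {c} 1 (\<lambda>xs. h2 (inv h1 (xs ! 0)))" by (simp only: PR_reducible_iff)
    have pz: "pr {c} k (\<lambda>xs. z (a xs))" if "pr {c} k a" for k a
      using pr_comp[OF ph prl_Cons[OF pr_node[OF pr_Suc[OF that] pr_const pr_const] prl_Nil]]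
      by (simp add: z_def)
    have z1: "orbit_type B2 (z j) = 1" for j
      unfolding z_def isomorphism_orbit_type[OF h2(1)] isomorphism_orbit_type[OF isomorphism_inv[OF h1(1)]]
      unfolding B1_def by (rule row_start_type_1[OF A(2)]) simp_all
    note row_z = orbit_type_1_row[OF A(2) z1[unfolded B2_def]]
    have inj_z: "inj (\<lambda>j. ind (row (z j)))"
    proof (rule injI)
      fix i j
      assume "ind (row (z i)) = ind (row (z j))"
      then have "row (z i) = row (z j)" using inj_onD[OF inj, of "row (z i)" "row (z j)"] row_z by simp
      then have "same_orbit B2 (z i) (z j)"
        using row_z(3)[of i] row_z(3)[of j] same_orbit_sym same_orbit_trans unfolding B2_def by metis
      then have "same_orbit B1 (node (Suc i) 0 0) (node (Suc j) 0 0)"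
        unfolding z_def isomorphism_same_orbit[OF h2(1)]
          isomorphism_same_orbit[OF isomorphism_inv[OF h1(1)]] .
      then show "i = j" using row_start_same_orbit[OF A(2)] unfolding B1_def by blast
    qed
    \<comment> \<open>Pigeonhole: the \<open>x + 1\<close> distinct values for
      \<open>j \<le> x\<close> cannot all lie below \<open>x\<close>.\<close>
    have ex_j: "\<exists>j<Suc x. x \<le> ind (row (z j))" for x
    proof -
      have "card ((\<lambda>j. ind (row (z j))) ` {..x}) = Suc x"
        using inj_z by (subst card_image) (auto intro: inj_on_subset)
      then have "\<not> (\<lambda>j. ind (row (z j))) ` {..x} \<subseteq> {..<x}"
        using card_mono[of "{..<x}" "(\<lambda>j. ind (row (z j))) ` {..x}"] by auto
      then show ?thesis by (auto simp: not_less less_Suc_eq_le)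
    qed
    \<comment> \<open>A bounded search suffices, since some \<open>j \<le> x\<close> succeeds; the
      default \<open>Suc x\<close> is never reached. This keeps the computation of \<open>f\<close>
      primitive recursive in \<open>c\<close>.\<close>
    define q where "q = (\<lambda>x. LEAST j. x \<le> ind (row (z j)) \<or> Suc x \<le> j)"
    have q: "x \<le> ind (row (z (q x)))" for x
    proof -
      obtain j where j: "j < Suc x" "x \<le> ind (row (z j))" using ex_j by blast
      have "x \<le> ind (row (z (q x))) \<or> Suc x \<le> q x"
        unfolding q_def using j(2) by (intro LeastI[of "\<lambda>j. x \<le> ind (row (z j)) \<or> Suc x \<le> j" j]) simp
      moreover have "q x \<le> j" unfolding q_def using j(2) by (intro Least_le) simp
      ultimately show ?thesis using j(1) by auto
    qed
    have pind: "pr {c} k (\<lambda>xs. ind (a xs))" if "pr {c} k a" for k a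
      using pr_comp[OF pr_mono[OF ind] prl_Cons[OF that prl_Nil]] by simp
    have pval: "pr {c} k (\<lambda>xs. val (a xs) (b xs))" if "pr {c} k a" "pr {c} k b" for k a b
      using pr_comp[OF pr_mono[OF val] prl_Cons[OF that(1) prl_Cons[OF that(2) prl_Nil]]] by simp
    have "pr {c} 1 (\<lambda>xs. val (row (z (q (xs ! 0)))) (xs ! 0))"
      unfolding q_def by (rule pval pind pz pr_intros | simp)+
    moreover have "val (row (z (q x))) x = f x" for x using f row_z(2) q by blast
    ultimately show ?thesis by (simp add: PR_reducible_iff)
  qed
  then show "d \<in> Cone_Delta0 3" using deg c by (simp add: Cone_Delta0_def)
qed

theorem theorem2p4:
  fixes A :: "nat \<Rightarrow> nat"
  assumes "punctual A" and "injection_structure A"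
    and "relatively_Delta0_categorical 3 A"
    and "\<not> relatively_Delta0_categorical 2 A"
  shows "PRCatSpec A = Cone_Delta0 3"
proof
  have "inj A" using assms(2) by (simp add: injection_structure_def)
  then have "infinite (orbit_reps A 0)" "infinite (orbit_reps A 1)"
    using relatively_Delta0_2_categorical assms(1,4) by blast+
  then show "PRCatSpec A \<subseteq> Cone_Delta0 3"
    by (rule PRCatSpec_subset_Cone_Delta0_3[OF assms(1) \<open>inj A\<close>])
  show "Cone_Delta0 3 \<subseteq> PRCatSpec A" by (rule Cone_Delta0_subset_PRCatSpec[OF assms(3)])
qed

end
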